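(* Let $X$ be a complex Banach space and let $T:D(T)\subset X\to X$ be a closed linear operator with nonempty resolvent set. Then $T$ has a purely B-discrete spectrum if and only if $\sigma_{BF}(T)=\emptyset$.
   Context: For a closed linear operator $T:D(T)\subset X\to X$, write $N(T)$, $R(T)$ for its nullspace and range and $\sigma(T)$ for its spectrum. Ascent: $a(T)=\inf\{n\in\mathbb N: N(T^n)=N(T^{n+1})\}$; descent: $\delta(T)=\inf\{n\in\mathbb N: R(T^n)=R(T^{n+1})\}$ (with $\inf\emptyset=\infty$, $\mathbb N=\{0,1,2,\dots\}$, and $T^n$ defined on its natural domain). $T$ is Drazin invertible if $a(T)$ and $\delta(T)$ are both finite. The Drazin spectrum is $\sigma_{D}(T)=\{\lambda\in\mathbb C: T-\lambda I\text{ is not Drazin invertible}\}$. The B-discrete spectrum is $\sigma_{bd}(T)=\sigma(T)\setminus\sigma_D(T)$, and $T$ has a purely B-discrete spectrum if $\sigma(T)=\sigma_{bd}(T)$. A closed operator is Fredholm if its nullspace has finite dimension and its range has finite codimension. A closed operator $T$ is B-Fredholm if there is an integer $n\ge 0$ such that $R(T^n)$ is closed and the restriction $T_{[n]}: D(T)\cap R(T^n)\to R(T^n)$ of $T$, viewed as an operator from $R(T^n)$ to $R(T^n)$, is Fredholm. The B-Fredholm spectrum is $\sigma_{BF}(T)=\{\lambda\in\mathbb C: T-\lambda I\text{ is not a B-Fredholm operator}\}$. *)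

theory Defs
  imports "HOL-Analysis.Analysis" "HOL-Library.Extended_Nat"
begin

section \<open>Complex Banach spaces\<close>

text \<open>
  HOL-Analysis has only real normed spaces. A complex Banach space is a real one together with
  a complex scalar multiplication that extends the real one and for which the norm is
  homogeneous.
\<close>

class complex_normed_vector = real_normed_vector +
  fixes scaleC :: "complex \<Rightarrow> 'a \<Rightarrow> 'a" (infixr "*\<^sub>C" 75)
  assumes scaleC_add_right: "a *\<^sub>C (x + y) = a *\<^sub>C x + a *\<^sub>C y"
    and scaleC_add_left: "(a + b) *\<^sub>C x = a *\<^sub>C x + b *\<^sub>C x"
    and scaleC_scaleC: "a *\<^sub>C (b *\<^sub>C x) = (a * b) *\<^sub>C x"
    and scaleC_one: "1 *\<^sub>C x = x"
    and scaleR_scaleC: "r *\<^sub>R x = complex_of_real r *\<^sub>C x"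
    and norm_scaleC: "norm (a *\<^sub>C x) = cmod a * norm x"

class complex_banach = complex_normed_vector + banach

instantiation complex :: complex_banach
begin

definition scaleC_complex :: "complex \<Rightarrow> complex \<Rightarrow> complex" where
  "scaleC_complex a x = a * x"

instance
  by standard (auto simp: scaleC_complex_def algebra_simps norm_mult scaleR_conv_of_real)

end

global_interpretation complex_vector: vector_space "scaleC :: complex \<Rightarrow> 'a \<Rightarrow> 'a::complex_normed_vector"
  by unfold_locales (simp_all add: scaleC_add_right scaleC_add_left scaleC_scaleC scaleC_one)

section \<open>Partially defined linear operators\<close>

text \<open>
  An operator \<open>T : D(T) \<subset> X \<rightarrow> X\<close> is a partial function \<open>T :: 'a \<rightharpoonup> 'a\<close>, so that \<open>D(T)\<close> is
  \<open>dom T\<close>, \<open>R(T)\<close> is \<open>ran T\<close>, and composition on the natural domain is \<open>\<circ>\<^sub>m\<close>.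
  The domain need not be dense.
\<close>

definition linear_operator :: "('a::complex_normed_vector \<rightharpoonup> 'a) \<Rightarrow> bool" where
  "linear_operator T \<longleftrightarrow>
     complex_vector.subspace (dom T) \<and>
     (\<forall>x y u v. T x = Some u \<longrightarrow> T y = Some v \<longrightarrow> T (x + y) = Some (u + v)) \<and>
     (\<forall>c x u. T x = Some u \<longrightarrow> T (c *\<^sub>C x) = Some (c *\<^sub>C u))"

definition closed_operator :: "('a::complex_normed_vector \<rightharpoonup> 'a) \<Rightarrow> bool" where
  "closed_operator T \<longleftrightarrow> linear_operator T \<and> closed (Map.graph T)"

definition nullspace :: "('a::complex_normed_vector \<rightharpoonup> 'a) \<Rightarrow> 'a set" where
  "nullspace T = {x. T x = Some 0}"

primrec op_power :: "('a \<rightharpoonup> 'a) \<Rightarrow> nat \<Rightarrow> ('a \<rightharpoonup> 'a)" where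
  "op_power T 0 = Some"
| "op_power T (Suc n) = T \<circ>\<^sub>m op_power T n"

text \<open>The operator \<open>T - \<mu>I\<close>, with domain \<open>D(T)\<close>.\<close>

definition op_shift :: "('a::complex_normed_vector \<rightharpoonup> 'a) \<Rightarrow> complex \<Rightarrow> ('a \<rightharpoonup> 'a)" where
  "op_shift T \<mu> x = map_option (\<lambda>y. y - \<mu> *\<^sub>C x) (T x)"

section \<open>Spectra\<close>

text \<open>
  \<open>T - \<mu>I\<close> maps \<open>D(T)\<close> bijectively onto \<open>X\<close> and its inverse \<open>R\<close> is bounded. Complex
  linearity of \<open>R\<close> is inherited from \<open>T\<close>.
\<close>

definition resolvent_set :: "('a::complex_normed_vector \<rightharpoonup> 'a) \<Rightarrow> complex set" where
  "resolvent_set T =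
     {\<mu>. \<exists>R. bounded_linear R \<and> (\<forall>x y. op_shift T \<mu> x = Some y \<longleftrightarrow> R y = x)}"

definition spectrum :: "('a::complex_normed_vector \<rightharpoonup> 'a) \<Rightarrow> complex set" where
  "spectrum T = - resolvent_set T"

text \<open>In \<open>enat\<close> the infimum of the empty set is \<open>\<infinity>\<close>.\<close>

definition ascent :: "('a::complex_normed_vector \<rightharpoonup> 'a) \<Rightarrow> enat" where
  "ascent T = Inf {enat n | n. nullspace (op_power T n) = nullspace (op_power T (n + 1))}"

definition descent :: "('a::complex_normed_vector \<rightharpoonup> 'a) \<Rightarrow> enat" where
  "descent T = Inf {enat n | n. ran (op_power T n) = ran (op_power T (n + 1))}"

definition Drazin_invertible :: "('a::complex_normed_vector \<rightharpoonup> 'a) \<Rightarrow> bool" where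
  "Drazin_invertible T \<longleftrightarrow> ascent T \<noteq> \<infinity> \<and> descent T \<noteq> \<infinity>"

definition Drazin_spectrum :: "('a::complex_normed_vector \<rightharpoonup> 'a) \<Rightarrow> complex set" where
  "Drazin_spectrum T = {\<mu>. \<not> Drazin_invertible (op_shift T \<mu>)}"

definition B_discrete_spectrum :: "('a::complex_normed_vector \<rightharpoonup> 'a) \<Rightarrow> complex set" where
  "B_discrete_spectrum T = spectrum T - Drazin_spectrum T"

definition purely_B_discrete_spectrum :: "('a::complex_normed_vector \<rightharpoonup> 'a) \<Rightarrow> bool" where
  "purely_B_discrete_spectrum T \<longleftrightarrow> spectrum T = B_discrete_spectrum T"

definition finite_dimensional :: "'a::complex_normed_vector set \<Rightarrow> bool" where
  "finite_dimensional M \<longleftrightarrow> (\<exists>B. finite B \<and> M = complex_vector.span B)"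

text \<open>
  The quotient of \<open>Y\<close> by its subspace \<open>M\<close> is finite-dimensional, that is, spanned by the
  classes of finitely many vectors of \<open>Y\<close>.
\<close>

definition finite_codimensional_in ::
    "'a::complex_normed_vector set \<Rightarrow> 'a set \<Rightarrow> bool" where
  "finite_codimensional_in Y M \<longleftrightarrow>
     (\<exists>B. finite B \<and> B \<subseteq> Y \<and> Y = {m + b | m b. m \<in> M \<and> b \<in> complex_vector.span B})"

text \<open>
  Fredholm operators acting in a closed subspace \<open>Y\<close> of the ambient space; since \<open>Y\<close> is closed,
  the graph is closed in \<open>Y \<times> Y\<close> iff it is closed in \<open>X \<times> X\<close>. The nullspace and range lie in
  \<open>Y\<close>, and the codimension is taken in \<open>Y\<close>.
\<close>

definition Fredholm_in :: "'a::complex_normed_vector set \<Rightarrow> ('a \<rightharpoonup> 'a) \<Rightarrow> bool" where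
  "Fredholm_in Y T \<longleftrightarrow>
     closed_operator T \<and> dom T \<subseteq> Y \<and> ran T \<subseteq> Y \<and>
     finite_dimensional (nullspace T) \<and> finite_codimensional_in Y (ran T)"

definition B_Fredholm :: "('a::complex_normed_vector \<rightharpoonup> 'a) \<Rightarrow> bool" where
  "B_Fredholm T \<longleftrightarrow>
     closed_operator T \<and>
     (\<exists>n. closed (ran (op_power T n)) \<and>
          Fredholm_in (ran (op_power T n)) (T |` ran (op_power T n)))"

definition B_Fredholm_spectrum :: "('a::complex_normed_vector \<rightharpoonup> 'a) \<Rightarrow> complex set" where
  "B_Fredholm_spectrum T = {\<mu>. \<not> B_Fredholm (op_shift T \<mu>)}"

end

theory Submission
  imports Defs
begin

text \<open>
  Fix \<open>\<mu>\<^sub>0\<close> in the resolvent set and put \<open>A = (T - \<mu>\<^sub>0I)\<inverse>\<close>. With \<open>\<nu> = \<kappa> - \<mu>\<^sub>0\<close> and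
  \<open>P \<nu> = I - \<nu>A\<close> one has \<open>T - \<kappa>I = P \<nu> \<circ> A\<inverse>\<close>. Since \<open>P \<nu>\<close> commutes with \<open>A\<close>, the powers of
  \<open>T - \<kappa>I\<close> and of \<open>P \<nu>\<close> have the same ranges and nullspaces, so everything reduces to the
  bounded operators \<open>P \<nu>\<close>.

  If \<open>P \<nu>\<close> has finite ascent and descent, then \<open>X\<close> is the direct sum of the nullspace and the range
  of some power, the range is closed by the open mapping theorem, and \<open>P \<nu>\<close> is bijective on it.

  Conversely, let \<open>P \<nu>\<close> be B-Fredholm and \<open>\<nu>\<close> a limit of points \<open>\<mu>\<close> with \<open>P \<mu>\<close> bijective. The
  kernels of \<open>P \<nu>\<close> on the ranges of its powers stabilise, and \<open>P \<nu>\<close> maps the intersection of these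
  ranges onto itself. A nonzero kernel there would persist under small perturbations, against the
  injectivity of \<open>P \<mu>\<close>; hence \<open>P \<nu>\<close> is injective, and even bounded below, on the range of some
  power. Solving \<open>P \<mu> x = y\<close> there and letting \<open>\<mu> \<rightarrow> \<nu>\<close> gives surjectivity, so \<open>P \<nu>\<close> has finite
  ascent and descent and \<open>P \<mu>\<close> is bijective for all \<open>\<mu> \<noteq> \<nu>\<close> close to \<open>\<nu>\<close>. If all \<open>P \<nu>\<close> are
  B-Fredholm, the closure of \<open>{\<mu>. bij (P \<mu>)}\<close> is therefore open as well, hence the whole plane.
\<close>

section \<open>Open mappings between closed subspaces\<close>

text \<open>Successive approximation: preimages that halve the error are applied repeatedly to the
  residual. The corrections are dominated by a geometric series with sum
  \<open>2 * C * norm y\<close>, so they converge, and the sum stays in the closed subspace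
  \<open>S\<close>.\<close>

lemma approximate_preimage_iterate:
  fixes f :: "'b::banach \<Rightarrow> 'c::real_normed_vector"
  assumes f: "bounded_linear f" and S: "subspace S" "closed S" and Y: "subspace Y" "f ` S \<subseteq> Y"
    and C: "0 \<le> C"
    and approx: "\<And>y. y \<in> Y \<Longrightarrow> \<exists>x\<in>S. norm x \<le> C * norm y \<and> norm (y - f x) \<le> norm y / 2"
    and y: "y \<in> Y"
  shows "\<exists>x\<in>S. f x = y \<and> norm x \<le> 2 * C * norm y"
proof -
  interpret f: bounded_linear f by fact
  obtain g where g: "\<And>y. y \<in> Y \<Longrightarrow> g y \<in> S \<and> norm (g y) \<le> C * norm y \<and> norm (y - f (g y)) \<le> norm y / 2"
    using approx by metis
  \<comment> \<open>\<open>r k\<close> is the residual after \<open>k\<close> corrections; the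
    images of the corrections telescope to \<open>y\<close>.\<close>
  define r where "r k = ((\<lambda>y. y - f (g y)) ^^ k) y" for k
  have r_Suc: "r (Suc k) = r k - f (g (r k))" for k
    by (simp add: r_def)
  have rY: "r k \<in> Y" for k
  proof (induction k)
    case 0
    then show ?case using y by (simp add: r_def)
  next
    case (Suc k)
    then show ?case using g[of "r k"] Y by (auto simp: r_Suc intro!: subspace_diff)
  qed
  have r_norm: "norm (r k) \<le> norm y * (1/2) ^ k" for k
  proof (induction k)
    case 0
    then show ?case by (simp add: r_def)
  next
    case (Suc k)
    then show ?case using g[OF rY[of k]] by (simp add: r_Suc)
  qed
  have gS: "g (r k) \<in> S" for k
    using g rY by blast
  have g_norm: "norm (g (r k)) \<le> C * norm y * (1/2) ^ k" for k
  proof -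
    have "norm (g (r k)) \<le> C * norm (r k)"
      using g rY by blast
    also have "\<dots> \<le> C * (norm y * (1/2) ^ k)"
      using r_norm C by (intro mult_left_mono)
    finally show ?thesis by (simp add: mult.assoc)
  qed
  have geo: "(\<lambda>k. C * norm y * (1/2) ^ k) sums (2 * C * norm y)"
    using sums_mult[OF geometric_sums[of "1/2 :: real"], of "C * norm y"] by (simp add: mult_ac)
  have norm_summable: "summable (\<lambda>k. norm (g (r k)))"
    using g_norm by (intro summable_comparison_test'[OF sums_summable[OF geo]]) auto
  then have sum: "summable (\<lambda>k. g (r k))"
    by (rule summable_norm_cancel)
  define x where "x = (\<Sum>k. g (r k))"
  have "(\<lambda>k. f (g (r k))) sums f x"
    unfolding x_def using f.sums[OF summable_sums[OF sum]] .
  moreover have "(\<lambda>k. f (g (r k))) sums y"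
  proof -
    have "r \<longlonglongrightarrow> 0"
    proof (rule Lim_null_comparison)
      show "(\<lambda>k. norm y * (1/2) ^ k) \<longlonglongrightarrow> 0"
        by (intro tendsto_mult_right_zero LIMSEQ_power_zero) auto
    qed (use r_norm in auto)
    from telescope_sums'[OF this] show ?thesis
      by (simp add: r_Suc r_def)
  qed
  ultimately have "f x = y"
    by (rule sums_unique2)
  moreover have "norm x \<le> 2 * C * norm y"
  proof -
    have "norm x \<le> (\<Sum>k. norm (g (r k)))"
      unfolding x_def by (rule summable_norm[OF norm_summable])
    also have "\<dots> \<le> 2 * C * norm y"
      using suminf_le[OF g_norm norm_summable sums_summable[OF geo]] sums_unique[OF geo] by simp
    finally show ?thesis .
  qed
  moreover have "x \<in> S"
  proof (rule closed_sequentially[OF S(2)])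
    show "(\<lambda>n. \<Sum>k<n. g (r k)) \<longlonglongrightarrow> x"
      using summable_sums[OF sum] by (simp add: sums_def x_def)
    show "(\<Sum>k<n. g (r k)) \<in> S" for n
      by (intro subspace_sum S gS)
  qed
  ultimately show ?thesis by blast
qed

text \<open>The open mapping theorem relative to subspaces, as a norm-controlled choice of
  preimages. The closed image is completely metrizable, so by Baire the closure of the image of some
  ball of \<open>S\<close> has interior in it; this yields approximate preimages.\<close>

lemma open_mapping_on:
  fixes f :: "'b::banach \<Rightarrow> 'c::banach"
  assumes f: "bounded_linear f" and S: "subspace S" "closed S" and cl: "closed (f ` S)"
  obtains K where "K > 0" "\<And>y. y \<in> f ` S \<Longrightarrow> \<exists>x\<in>S. f x = y \<and> norm x \<le> K * norm y"
proof -
  interpret f: bounded_linear f by fact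
  let ?Y = "f ` S"
  have Y: "subspace ?Y"
    using linear_subspace_image[OF f.linear_axioms S(1)] .
  define F where "F n = closure (f ` (S \<inter> cball 0 (real n)))" for n
  have F_sub: "F n \<subseteq> ?Y" for n
    unfolding F_def using cl by (intro closure_minimal image_mono) simp_all
  have closed_F: "closed (F n)" for n
    by (simp add: F_def)
  have cover: "\<Union> (range F) = ?Y"
  proof
    show "?Y \<subseteq> \<Union> (range F)"
    proof
      fix y assume "y \<in> ?Y"
      then obtain x where "x \<in> S" "y = f x" by auto
      moreover obtain n where "norm x \<le> real n" using real_arch_simple by blast
      ultimately have "y \<in> F n"
        unfolding F_def by (intro subsetD[OF closure_subset]) auto
      then show "y \<in> \<Union> (range F)" by blast
    qed
  qed (use F_sub in blast)
  have "\<exists>n. top_of_set ?Y interior_of F n \<noteq> {}"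
  proof (rule ccontr)
    assume contra: "\<nexists>n. top_of_set ?Y interior_of F n \<noteq> {}"
    have "top_of_set ?Y interior_of \<Union> (range F) = {}"
    proof (rule Baire_category_alt)
      have "completely_metrizable_space (top_of_set ?Y)"
        using cl completely_metrizable_space_closedin[OF completely_metrizable_space_euclidean]
        by (simp only: closed_closedin)
      then show "completely_metrizable_space (top_of_set ?Y) \<or>
          locally_compact_space (top_of_set ?Y) \<and> regular_space (top_of_set ?Y)" ..
      show "closedin (top_of_set ?Y) T \<and> top_of_set ?Y interior_of T = {}" if "T \<in> range F" for T
        using that contra closed_subset[OF F_sub closed_F] by (metis rangeE)
    qed simp
    then have "?Y = {}"
      using cover interior_of_topspace[of "top_of_set ?Y"] by simp
    then show False using subspace_0[OF S(1)] by (simp only: image_is_empty empty_iff)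
  qed
  then obtain n y0 where "y0 \<in> top_of_set ?Y interior_of F n" by blast
  then obtain U where U: "openin (top_of_set ?Y) U" "y0 \<in> U" "U \<subseteq> F n"
    by (auto simp: interior_of_def)
  then have y0: "y0 \<in> ?Y" by (meson openin_imp_subset subsetD)
  from U obtain r where r: "r > 0" "ball y0 r \<inter> ?Y \<subseteq> U"
    unfolding openin_contains_ball by blast
  \<comment> \<open>Both \<open>y0 + y\<close> and \<open>y0\<close> are limits of images from the
    ball of radius \<open>n\<close>; the difference of two such preimages serves
    \<open>y\<close>.\<close>
  have near: "\<exists>x\<in>S. norm x \<le> 2 * real n \<and> norm (y - f x) < e" if "y \<in> ?Y" "norm y < r" "e > 0" for y e
  proof -
    have "y0 + y \<in> ball y0 r \<inter> ?Y"
      using that subspace_add[OF Y y0 that(1)] by (simp add: dist_norm)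
    then have "y0 + y \<in> F n" "y0 \<in> F n"
      using r U by blast+
    moreover have "e / 2 > 0" using \<open>e > 0\<close> by simp
    ultimately have "\<exists>z\<in>f ` (S \<inter> cball 0 (real n)). dist z (y0 + y) < e / 2"
        "\<exists>z\<in>f ` (S \<inter> cball 0 (real n)). dist z y0 < e / 2"
      unfolding F_def closure_approachable by blast+
    then obtain x1 x2 where x: "x1 \<in> S" "norm x1 \<le> n" "dist (f x1) (y0 + y) < e / 2"
        "x2 \<in> S" "norm x2 \<le> n" "dist (f x2) y0 < e / 2"
      by fastforce
    have "y - f (x1 - x2) = (f x2 - y0) - (f x1 - (y0 + y))"
      by (simp add: f.diff)
    then have "norm (y - f (x1 - x2)) \<le> norm (f x2 - y0) + norm (f x1 - (y0 + y))"
      by (metis norm_triangle_ineq4)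
    moreover have "norm (x1 - x2) \<le> 2 * real n"
      using norm_triangle_ineq4[of x1 x2] x by linarith
    ultimately show ?thesis
      using x S by (intro bexI[of _ "x1 - x2"]) (auto simp: dist_norm subspace_diff)
  qed
  \<comment> \<open>Rescaling \<open>y\<close> to norm \<open>r / 2\<close> turns the bound
    \<open>2 * n\<close> into \<open>4 * n / r * norm y\<close>; the summand 1 keeps
    \<open>C\<close> positive when \<open>n = 0\<close>.\<close>
  define C where "C = 4 * real n / r + 1"
  have "C > 0" using r by (simp add: C_def add_nonneg_pos)
  have approx: "\<exists>x\<in>S. norm x \<le> C * norm y \<and> norm (y - f x) \<le> norm y / 2" if y: "y \<in> ?Y" for y
  proof (cases "y = 0")
    case True
    then show ?thesis using subspace_0[OF S(1)] by (intro bexI[of _ 0]) (auto simp: f.zero)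
  next
    case False
    define c where "c = r / (2 * norm y)"
    have c: "c > 0" using False r by (simp add: c_def)
    have "norm (c *\<^sub>R y) < r" using False r by (simp add: c_def)
    moreover have "c *\<^sub>R y \<in> ?Y" using y Y by (simp add: subspace_scale)
    moreover have "c * (norm y / 2) > 0" using c False by simp
    ultimately obtain x where x: "x \<in> S" "norm x \<le> 2 * real n" "norm (c *\<^sub>R y - f x) < c * (norm y / 2)"
      using near by blast
    let ?x = "(1 / c) *\<^sub>R x"
    have "y - f ?x = (1 / c) *\<^sub>R (c *\<^sub>R y - f x)"
      using c by (simp add: f.scaleR scaleR_diff_right)
    then have "norm (y - f ?x) = norm (c *\<^sub>R y - f x) / c"
      using c by simp
    also have "\<dots> \<le> norm y / 2"
      using x(3) c by (simp add: field_simps)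
    finally have "norm (y - f ?x) \<le> norm y / 2" .
    moreover have "norm ?x \<le> C * norm y"
    proof -
      have "norm ?x = norm x / c" using c by simp
      also have "\<dots> \<le> 2 * real n / c" using x(2) c by (simp add: divide_right_mono)
      also have "\<dots> = 4 * real n / r * norm y" by (simp add: c_def)
      also have "\<dots> \<le> C * norm y" by (simp add: C_def distrib_right)
      finally show ?thesis .
    qed
    moreover have "?x \<in> S" using x(1) S by (simp add: subspace_scale)
    ultimately show ?thesis by blast
  qed
  show ?thesis
  proof (rule that[of "2 * C"])
    show "2 * C > 0" using \<open>C > 0\<close> by simp
    show "\<exists>x\<in>S. f x = y \<and> norm x \<le> 2 * C * norm y" if "y \<in> f ` S" for y
      using approximate_preimage_iterate[OF f S Y subset_refl _ approx that] \<open>C > 0\<close> by simp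
  qed
qed

text \<open>The sum map on \<open>S \<times> N\<close> has closed image, so decompositions come with
  norm control. If images \<open>y n\<close> of points of \<open>S\<close> converge to
  \<open>l = f s + v\<close>, then \<open>v\<close> is the \<open>N\<close>-part of every
  \<open>l - y n\<close>, and these differences tend to 0.\<close>

lemma closed_range_of_closed_complement:
  fixes f :: "'b::banach \<Rightarrow> 'c::banach"
  assumes f: "bounded_linear f" and S: "subspace S" "closed S" and N: "subspace N" "closed N"
    and int: "f ` S \<inter> N = {0}" and cl: "closed {u + v |u v. u \<in> f ` S \<and> v \<in> N}"
  shows "closed (f ` S)"
proof -
  interpret f: bounded_linear f by fact
  define g where "g = (\<lambda>p. f (fst p) + snd p)"
  have g: "bounded_linear g"
    unfolding g_def
    by (intro bounded_linear_add bounded_linear_compose[OF f] bounded_linear_fst bounded_linear_snd)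
  have image: "g ` (S \<times> N) = {u + v |u v. u \<in> f ` S \<and> v \<in> N}"
  proof (intro set_eqI iffI)
    fix y assume "y \<in> {u + v |u v. u \<in> f ` S \<and> v \<in> N}"
    then obtain s v where "s \<in> S" "v \<in> N" "y = g (s, v)" by (auto simp: g_def)
    then show "y \<in> g ` (S \<times> N)" by blast
  qed (unfold g_def, force)
  have cl': "closed (g ` (S \<times> N))"
    using cl image by simp
  obtain K where "K > 0"
    and K: "\<And>y. y \<in> g ` (S \<times> N) \<Longrightarrow> \<exists>p\<in>S \<times> N. g p = y \<and> norm p \<le> K * norm y"
    by (rule open_mapping_on[OF g subspace_Times[OF S(1) N(1)] closed_Times[OF S(2) N(2)] cl'])
      (rule that)
  show ?thesis
  proof (rule closed_sequential_limits[THEN iffD2], intro allI impI, elim conjE)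
    fix y l assume "\<forall>n. y n \<in> f ` S" and lim: "y \<longlonglongrightarrow> l"
    then have "\<forall>n. \<exists>s. s \<in> S \<and> y n = f s" by blast
    then obtain x where x: "\<And>n. x n \<in> S" "\<And>n. y n = f (x n)"
      using choice[of "\<lambda>n s. s \<in> S \<and> y n = f s"] by blast
    have sub: "f ` S \<subseteq> g ` (S \<times> N)"
    proof
      fix w assume "w \<in> f ` S"
      then obtain s where "s \<in> S" "w = f s" by auto
      then have "w = g (s, 0)" by (simp add: g_def)
      then show "w \<in> g ` (S \<times> N)" using \<open>s \<in> S\<close> subspace_0[OF N(1)] by blast
    qed
    have "l \<in> g ` (S \<times> N)"
      using closed_sequentially[OF cl' _ lim] sub x by blast
    then obtain s v where sv: "s \<in> S" "v \<in> N" "l = f s + v" by (auto simp: g_def)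
    have "norm v \<le> K * norm (l - y n)" for n
    proof -
      have "l - y n = g (s - x n, v)" using sv x by (simp add: g_def f.diff)
      then have "l - y n \<in> g ` (S \<times> N)" using sv x S by (simp add: subspace_diff)
      then obtain s' v' where sv': "s' \<in> S" "v' \<in> N" "f s' + v' = l - y n"
          "norm (s', v') \<le> K * norm (l - y n)"
        using K by (fastforce simp: g_def)
      \<comment> \<open>The norm-controlled decomposition may have another \<open>S\<close>-part,
        but its \<open>N\<close>-part is \<open>v\<close>, as the image of \<open>S\<close> meets
        \<open>N\<close> only in 0.\<close>
      have "f (s' - (s - x n)) = v - v'" using sv' sv x by (simp add: f.add f.diff algebra_simps)
      moreover have "s' - (s - x n) \<in> S" "v - v' \<in> N"
        using sv sv' x S(1) N(1) by (simp_all add: subspace_diff)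
      ultimately have "v - v' \<in> f ` S \<inter> N" by (metis IntI image_eqI)
      then have "v = v'" using int by simp
      then show ?thesis using sv'(4) norm_snd_le[of v' s'] by simp
    qed
    moreover have "(\<lambda>n. K * norm (l - y n)) \<longlonglongrightarrow> 0"
      using tendsto_mult_right_zero[OF tendsto_norm_zero[OF LIM_zero[OF lim]]]
      by (simp add: norm_minus_commute)
    ultimately have "norm v \<le> 0"
      by (meson LIMSEQ_le_const order_refl)
    then show "l \<in> f ` S" using sv by simp
  qed
qed

section \<open>Finite dimension and codimension in complex normed spaces\<close>

lemma subspace_of_complex_subspace:
  "complex_vector.subspace S \<Longrightarrow> subspace S"
  by (simp add: complex_vector.subspace_def subspace_def scaleR_scaleC)

lemma bounded_linear_scaleC_left: "bounded_linear (\<lambda>c. c *\<^sub>C x)"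
  by (rule bounded_linear_intro[of _ "norm x"])
    (simp_all add: scaleC_add_left norm_scaleC scaleR_scaleC scaleC_scaleC scaleC_complex_def)

lemma bounded_linear_scaleC_right: "bounded_linear (\<lambda>x. c *\<^sub>C x)"
  by (rule bounded_linear_intro[of _ "cmod c"])
    (simp_all add: scaleC_add_right norm_scaleC scaleR_scaleC scaleC_scaleC mult.commute)

text \<open>If a ball of radius \<open>d\<close> around \<open>b\<close> misses \<open>S\<close>,
  then \<open>cmod k * d \<le> norm x\<close>. Along a convergent sequence the coefficients are thus
  bounded, and a subsequence of them converges.\<close>

lemma closed_insert_direction:
  fixes S :: "'a::complex_normed_vector set"
  assumes S: "complex_vector.subspace S" "closed S"
  shows "closed {x. \<exists>k. x - k *\<^sub>C b \<in> S}"
proof (cases "b \<in> S")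
  case True
  have "x \<in> S" if "x - k *\<^sub>C b \<in> S" for x k
    using complex_vector.subspace_add[OF S(1) that complex_vector.subspace_scale[OF S(1) True, of k]]
    by simp
  moreover have "\<exists>k. x - k *\<^sub>C b \<in> S" if "x \<in> S" for x
    using that by (intro exI[of _ 0]) simp
  ultimately have "{x. \<exists>k. x - k *\<^sub>C b \<in> S} = S" by blast
  then show ?thesis using S by simp
next
  case False
  obtain d where d: "d > 0" "ball b d \<subseteq> - S"
    using S(2) False by (metis ComplI open_Compl open_contains_ball)
  have coeff: "cmod k * d \<le> norm x" if "x - k *\<^sub>C b \<in> S" for x k
  proof (cases "k = 0")
    case False
    have "- (1 / k) *\<^sub>C (x - k *\<^sub>C b) \<in> S"
      using that S complex_vector.subspace_scale by blast
    moreover have "- (1 / k) *\<^sub>C (x - k *\<^sub>C b) = b - (1 / k) *\<^sub>C x"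
      using False by (simp add: complex_vector.scale_right_diff_distrib scaleC_scaleC scaleC_one
          complex_vector.scale_minus_left)
    ultimately have "b - (1 / k) *\<^sub>C x \<notin> ball b d"
      using d(2) by (metis ComplD subsetD)
    then have "d \<le> norm ((1 / k) *\<^sub>C x)"
      by (simp add: dist_norm)
    then have "d \<le> norm x / cmod k"
      by (simp add: norm_scaleC norm_divide)
    then show ?thesis using False by (simp add: field_simps)
  qed simp
  show ?thesis
  proof (rule closed_sequential_limits[THEN iffD2], intro allI impI, elim conjE)
    fix x l assume "\<forall>n. x n \<in> {x. \<exists>k. x - k *\<^sub>C b \<in> S}" and lim: "x \<longlonglongrightarrow> l"
    then obtain k where k: "\<And>n. x n - k n *\<^sub>C b \<in> S" by (simp add: choice_iff) blast
    obtain C where C: "\<And>n. norm (x n) \<le> C"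
      using convergent_imp_Bseq[OF convergentI[OF lim]] by (auto simp: Bseq_def)
    have "cmod (k n) \<le> C / d" for n
      using coeff[OF k[of n]] C[of n] d by (simp add: field_simps)
    then have "bounded (range k)" by (auto simp: bounded_iff)
    then obtain c r where r: "strict_mono r" "(k \<circ> r) \<longlonglongrightarrow> c"
      using bounded_imp_convergent_subsequence by blast
    have "(\<lambda>n. x (r n) - k (r n) *\<^sub>C b) \<longlonglongrightarrow> l - c *\<^sub>C b"
      using LIMSEQ_subseq_LIMSEQ[OF lim r(1)]
        bounded_linear.tendsto[OF bounded_linear_scaleC_left r(2), of b]
      by (intro tendsto_diff) (simp_all add: o_def)
    then have "l - c *\<^sub>C b \<in> S"
      by (rule closed_sequentially[OF S(2), rotated]) (rule k)
    then show "l \<in> {x. \<exists>k. x - k *\<^sub>C b \<in> S}" by blast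
  qed
qed

lemma closed_complex_span:
  fixes B :: "'a::complex_normed_vector set"
  assumes "finite B"
  shows "closed (complex_vector.span B)"
  using assms
proof induction
  case (insert b B)
  then show ?case
    unfolding complex_vector.span_insert
    by (intro closed_insert_direction complex_vector.subspace_span)
qed simp

text \<open>The vectors of \<open>B\<close> are taken one at a time, and one is kept only if it is
  not yet in the sum; this makes the sum with \<open>W\<close> direct.\<close>

lemma complement_of_finite_codimension:
  fixes W :: "'a::complex_normed_vector set"
  assumes W: "complex_vector.subspace W" and "finite B"
  shows "\<exists>B'. finite B' \<and> W \<inter> complex_vector.span B' = {0} \<and>
    {w + b |w b. w \<in> W \<and> b \<in> complex_vector.span B'} = {w + b |w b. w \<in> W \<and> b \<in> complex_vector.span B}"
  using \<open>finite B\<close>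
proof induction
  case empty
  show ?case using complex_vector.subspace_0[OF W] by (intro exI[of _ "{}"]) auto
next
  case (insert b B)
  let ?s = "complex_vector.span" and ?sum = "\<lambda>V. {w + b |w b. w \<in> W \<and> b \<in> V}"
  have sub: "complex_vector.subspace (?sum (?s C))" for C
    by (intro complex_vector.subspace_sums W complex_vector.subspace_span)
  have step: "?sum (?s (insert b C)) = {x. \<exists>k. x - k *\<^sub>C b \<in> ?sum (?s C)}" for C
  proof (intro set_eqI iffI)
    fix x assume "x \<in> ?sum (?s (insert b C))"
    then obtain w v k where "w \<in> W" "x = w + v" "v - k *\<^sub>C b \<in> ?s C"
      unfolding complex_vector.span_insert by blast
    moreover from this have "x - k *\<^sub>C b = w + (v - k *\<^sub>C b)" by simp
    ultimately show "x \<in> {x. \<exists>k. x - k *\<^sub>C b \<in> ?sum (?s C)}" by blast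
  next
    fix x assume "x \<in> {x. \<exists>k. x - k *\<^sub>C b \<in> ?sum (?s C)}"
    then obtain k w v where "w \<in> W" "v \<in> ?s C" "x - k *\<^sub>C b = w + v" by blast
    moreover from this have "x = w + (v + k *\<^sub>C b)" "(v + k *\<^sub>C b) - k *\<^sub>C b \<in> ?s C"
      by (metis add.assoc diff_add_cancel) (simp add: \<open>v \<in> ?s C\<close>)
    ultimately show "x \<in> ?sum (?s (insert b C))"
      unfolding complex_vector.span_insert by blast
  qed
  from insert obtain B' where B': "finite B'" "W \<inter> ?s B' = {0}" "?sum (?s B') = ?sum (?s B)"
    by blast
  show ?case
  proof (cases "b \<in> ?sum (?s B)")
    case True
    have "{x. \<exists>k. x - k *\<^sub>C b \<in> ?sum (?s B)} = ?sum (?s B)" (is "?L = ?R")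
    proof
      show "?L \<subseteq> ?R"
      proof
        fix x assume "x \<in> ?L"
        then obtain k where "x - k *\<^sub>C b \<in> ?R" by blast
        then have "(x - k *\<^sub>C b) + k *\<^sub>C b \<in> ?R"
          by (rule complex_vector.subspace_add[OF sub _ complex_vector.subspace_scale[OF sub True]])
        then show "x \<in> ?R" by (simp only: diff_add_cancel)
      qed
      have "x - 0 *\<^sub>C b \<in> ?R" if "x \<in> ?R" for x using that by simp
      then show "?R \<subseteq> ?L" by blast
    qed
    then show ?thesis using B' step[of B] by (intro exI[of _ B']) simp
  next
    case False
    have "W \<inter> ?s (insert b B') = {0}"
    proof -
      have "x = 0" if "x \<in> W" "x \<in> ?s (insert b B')" for x
      proof -
        from that obtain k where k: "x - k *\<^sub>C b \<in> ?s B'"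
          unfolding complex_vector.span_insert by blast
        have "k = 0"
        proof (rule ccontr)
          assume "k \<noteq> 0"
          have "k *\<^sub>C b = x + - (x - k *\<^sub>C b)" by simp
          then have "k *\<^sub>C b \<in> ?sum (?s B')"
            using that k complex_vector.span_neg by blast
          then have "(1 / k) *\<^sub>C k *\<^sub>C b \<in> ?sum (?s B')"
            using complex_vector.subspace_scale[OF sub] by blast
          then show False using False B'(3) \<open>k \<noteq> 0\<close> by (simp add: scaleC_scaleC scaleC_one)
        qed
        then show ?thesis using k that B'(2) by auto
      qed
      then show ?thesis
        using complex_vector.subspace_0[OF W] complex_vector.span_zero by blast
    qed
    moreover have "?sum (?s (insert b B')) = ?sum (?s (insert b B))"
      using step[of B] step[of B'] B'(3) by simp
    ultimately show ?thesis using B'(1) by (intro exI[of _ "insert b B'"]) simp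
  qed
qed

text \<open>A range of finite codimension has a finite-dimensional, hence closed, complement, and
  the sum of the two is the closed space \<open>Y\<close>.\<close>

lemma closed_range_of_finite_codimension:
  fixes f :: "'b::banach \<Rightarrow> 'a::complex_banach"
  assumes f: "bounded_linear f" and S: "subspace S" "closed S"
    and sub: "complex_vector.subspace (f ` S)"
    and Y: "closed Y" and fin: "finite_codimensional_in Y (f ` S)"
  shows "closed (f ` S)"
proof -
  obtain B where "finite B" and B: "Y = {m + b |m b. m \<in> f ` S \<and> b \<in> complex_vector.span B}"
    using fin unfolding finite_codimensional_in_def by blast
  obtain B' where "finite B'" "f ` S \<inter> complex_vector.span B' = {0}"
    "{m + b |m b. m \<in> f ` S \<and> b \<in> complex_vector.span B'} = Y"
    using complement_of_finite_codimension[OF sub \<open>finite B\<close>] B by auto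
  then show ?thesis
    using closed_range_of_closed_complement[OF f S
        subspace_of_complex_subspace[OF complex_vector.subspace_span] closed_complex_span]
      Y by auto
qed

text \<open>The dimension is minimal at some \<open>K m\<close>. If a later \<open>K k\<close> were
  a proper subspace, a basis of it could be extended by a vector of \<open>K m\<close>, so its
  dimension would fall below the minimum.\<close>

lemma finite_dimensional_chain_stable:
  fixes K :: "nat \<Rightarrow> 'a::complex_normed_vector set"
  assumes K: "\<And>k. complex_vector.subspace (K k)" and dec: "decseq K"
    and fin: "finite_dimensional (K 0)"
  obtains m where "\<And>k. m \<le> k \<Longrightarrow> K k = K m"
proof -
  obtain B where B: "finite B" "K 0 = complex_vector.span B"
    using fin unfolding finite_dimensional_def by blast
  have in_span: "K k \<subseteq> complex_vector.span B" for k
    using B(2) decseqD[OF dec, of 0 k] by simp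
  obtain m where m: "\<And>k. complex_vector.dim (K m) \<le> complex_vector.dim (K k)"
    using ex_has_least_nat[of "\<lambda>_. True" 0 "\<lambda>k. complex_vector.dim (K k)"] by (metis TrueI)
  show ?thesis
  proof (rule that[of m], rule ccontr)
    fix k assume "m \<le> k" and ne: "K k \<noteq> K m"
    then have le: "K k \<subseteq> K m" using dec by (simp add: decseqD)
    obtain C where C: "C \<subseteq> K k" "complex_vector.independent C" "K k \<subseteq> complex_vector.span C"
        "card C = complex_vector.dim (K k)"
      using complex_vector.basis_exists by blast
    obtain D where D: "D \<subseteq> K m" "complex_vector.independent D" "K m \<subseteq> complex_vector.span D"
        "card D = complex_vector.dim (K m)"
      using complex_vector.basis_exists by blast
    have "finite C" "finite D"
      using complex_vector.independent_span_bound[OF B(1) C(2) order_trans[OF C(1) in_span]]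
        complex_vector.independent_span_bound[OF B(1) D(2) order_trans[OF D(1) in_span]]
      by blast+
    obtain v where v: "v \<in> K m" "v \<notin> K k" using le ne by blast
    have "v \<notin> complex_vector.span C"
      using v(2) complex_vector.span_minimal[OF C(1) K] by (rule_tac contra_subsetD)
    then have "complex_vector.independent (insert v C)" "v \<notin> C"
      using complex_vector.independent_insertI[OF _ C(2)] complex_vector.span_base[of v C] by auto
    then have "card (insert v C) \<le> card D"
      using complex_vector.independent_span_bound[OF \<open>finite D\<close>, of "insert v C"] v(1) C(1) le D(3)
      by (metis insert_subset order_trans)
    then show False
      using card_insert_disjoint[OF \<open>finite C\<close> \<open>v \<notin> C\<close>] C(4) D(4) m[of k] by linarith
  qed
qed

section \<open>Perturbations of surjective operators\<close>

text \<open>A \<open>B\<close>-preimage \<open>x\<close> of \<open>y\<close> misses the equation for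
  \<open>B - D\<close> only by \<open>D x\<close>, whose norm is at most half of
  \<open>norm y\<close>; iterating costs a factor 2 in the bound.\<close>

lemma surjective_perturbation:
  fixes B D :: "'a::banach \<Rightarrow> 'a"
  assumes B: "bounded_linear B" and D: "bounded_linear D" and M: "subspace M" "closed M"
    and inv: "B ` M \<subseteq> M" "D ` M \<subseteq> M" and C: "C \<ge> 0"
    and lift: "\<And>y. y \<in> M \<Longrightarrow> \<exists>x\<in>M. B x = y \<and> norm x \<le> C * norm y"
    and small: "\<And>x. x \<in> M \<Longrightarrow> norm (D x) \<le> \<delta> * norm x" and \<delta>: "\<delta> \<ge> 0" "C * \<delta> \<le> 1 / 2"
    and y: "y \<in> M"
  shows "\<exists>x\<in>M. B x - D x = y \<and> norm x \<le> 2 * C * norm y"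
proof (rule approximate_preimage_iterate[OF bounded_linear_sub[OF B D] M M(1) _ C _ y])
  show "(\<lambda>x. B x - D x) ` M \<subseteq> M" using inv M by (auto intro!: subspace_diff)
  fix y assume "y \<in> M"
  then obtain x where x: "x \<in> M" "B x = y" "norm x \<le> C * norm y" using lift by blast
  have "norm (D x) \<le> \<delta> * (C * norm y)"
    using small[OF x(1)] x(3) \<delta> by (meson mult_left_mono order_trans)
  also have "\<dots> = (C * \<delta>) * norm y" by simp
  also have "\<dots> \<le> (1 / 2) * norm y" using \<delta>(2) by (intro mult_right_mono) auto
  finally show "\<exists>x\<in>M. norm x \<le> C * norm y \<and> norm (y - (B x - D x)) \<le> norm y / 2"
    using x by auto
qed

text \<open>A kernel vector \<open>x\<close> of \<open>B\<close> persists under perturbation: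
  solving \<open>B w - D w = D x\<close> makes \<open>x + w\<close> a kernel vector of
  \<open>B - D\<close>. Injectivity gives \<open>w = - x\<close>, yet
  \<open>norm w \<le> 2 * C * \<delta> * norm x\<close> with a factor below 1.\<close>

lemma injective_of_injective_perturbations:
  fixes B D :: "'a::banach \<Rightarrow> 'a"
  assumes B: "bounded_linear B" and D: "bounded_linear D" and M: "subspace M" "closed M"
    and inv: "B ` M \<subseteq> M" "D ` M \<subseteq> M" and C: "C \<ge> 0"
    and lift: "\<And>y. y \<in> M \<Longrightarrow> \<exists>x\<in>M. B x = y \<and> norm x \<le> C * norm y"
    and small: "\<And>x. x \<in> M \<Longrightarrow> norm (D x) \<le> \<delta> * norm x" and \<delta>: "\<delta> \<ge> 0" "C * \<delta> < 1 / 2"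
    and inj: "\<And>x. B x - D x = 0 \<Longrightarrow> x = 0"
    and x: "x \<in> M" "B x = 0"
  shows "x = 0"
proof -
  interpret B: bounded_linear B by fact
  interpret D: bounded_linear D by fact
  obtain w where w: "B w - D w = D x" "norm w \<le> 2 * C * norm (D x)"
    using surjective_perturbation[OF B D M inv C lift small \<delta>(1), of "D x"] \<delta>(2) x(1) inv by fastforce
  have "B (x + w) - D (x + w) = 0"
    using w(1) x(2) by (simp add: B.add D.add algebra_simps)
  then have "w = - x" using inj by (simp add: eq_neg_iff_add_eq_0 add.commute)
  then have "norm x \<le> 2 * C * norm (D x)" using w(2) by simp
  also have "\<dots> \<le> 2 * C * (\<delta> * norm x)"
    using C small[OF x(1)] by (intro mult_left_mono) auto
  also have "\<dots> = (2 * (C * \<delta>)) * norm x" by simp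
  finally have "(1 - 2 * (C * \<delta>)) * norm x \<le> 0" by (simp add: algebra_simps)
  then show ?thesis using \<delta>(2) by (simp add: mult_le_0_iff)
qed

section \<open>The bounded operators \<open>I - \<nu>A\<close>\<close>

locale bounded_pencil =
  fixes A :: "'a::complex_banach \<Rightarrow> 'a"
  assumes A: "bounded_linear A" and A_scaleC: "A (c *\<^sub>C x) = c *\<^sub>C A x"
begin

sublocale A: bounded_linear A
  by (rule A)

definition P :: "complex \<Rightarrow> 'a \<Rightarrow> 'a" where
  "P \<nu> x = x - \<nu> *\<^sub>C A x"

section \<open>Linearity and commutation relations of the operators \<open>P \<nu>\<close>\<close>

lemma P_linear:
  "P \<nu> 0 = 0" "P \<nu> (x + y) = P \<nu> x + P \<nu> y" "P \<nu> (x - y) = P \<nu> x - P \<nu> y"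
  "P \<nu> (c *\<^sub>C x) = c *\<^sub>C P \<nu> x"
  by (simp_all add: P_def A.zero A.add A.diff A_scaleC algebra_simps scaleC_add_right scaleC_scaleC
      complex_vector.scale_right_diff_distrib)

lemma bounded_linear_P: "bounded_linear (P \<nu>)"
  unfolding P_def
  by (intro bounded_linear_sub bounded_linear_ident bounded_linear_compose[OF bounded_linear_scaleC_right] A)

lemma P_power_linear:
  "(P \<nu> ^^ n) 0 = 0" "(P \<nu> ^^ n) (x + y) = (P \<nu> ^^ n) x + (P \<nu> ^^ n) y"
  "(P \<nu> ^^ n) (x - y) = (P \<nu> ^^ n) x - (P \<nu> ^^ n) y"
  "(P \<nu> ^^ n) (c *\<^sub>C x) = c *\<^sub>C (P \<nu> ^^ n) x"
  by (induction n) (simp_all add: P_linear)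

lemma bounded_linear_P_power: "bounded_linear (P \<nu> ^^ n)"
  by (induction n)
    (simp_all add: bounded_linear_ident[folded id_def] o_def bounded_linear_compose[OF bounded_linear_P])

lemma P_A: "P \<nu> (A x) = A (P \<nu> x)"
  by (simp add: P_def A.diff A_scaleC)

lemma P_P: "P \<nu> (P \<mu> x) = P \<mu> (P \<nu> x)"
  by (simp add: P_def A.diff A_scaleC algebra_simps complex_vector.scale_right_diff_distrib scaleC_scaleC)

lemma P_power_A: "(P \<nu> ^^ n) (A x) = A ((P \<nu> ^^ n) x)"
  by (induction n) (simp_all add: P_A)

lemma P_power_P: "(P \<nu> ^^ n) (P \<mu> x) = P \<mu> ((P \<nu> ^^ n) x)"
  by (induction n) (simp_all add: P_P)

lemma P_shift: "P \<mu> x = P \<nu> x - (\<mu> - \<nu>) *\<^sub>C A x"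
  by (simp add: P_def complex_vector.scale_left_diff_distrib)

text \<open>For \<open>\<mu> \<noteq> \<nu>\<close> the commuting operators \<open>P \<mu>\<close>
  and \<open>P \<nu>\<close> are coprime: a combination of them is a nonzero multiple of the
  identity.\<close>

lemma P_combination: "(\<mu> - \<nu>) *\<^sub>C x = \<mu> *\<^sub>C P \<nu> x - \<nu> *\<^sub>C P \<mu> x"
  by (simp add: P_def complex_vector.scale_left_diff_distrib complex_vector.scale_right_diff_distrib
      scaleC_scaleC mult.commute)

section \<open>Ranges of the powers: invariance, codimension and closedness\<close>

lemma subspace_range_P_power: "complex_vector.subspace (range (P \<nu> ^^ n))"
proof (rule complex_vector.subspaceI)
  show "0 \<in> range (P \<nu> ^^ n)" by (rule range_eqI[of _ _ 0]) (simp add: P_power_linear)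
next
  fix x y assume "x \<in> range (P \<nu> ^^ n)" "y \<in> range (P \<nu> ^^ n)"
  then obtain u v where "x = (P \<nu> ^^ n) u" "y = (P \<nu> ^^ n) v" by blast
  then show "x + y \<in> range (P \<nu> ^^ n)"
    by (intro range_eqI[of _ _ "u + v"]) (simp add: P_power_linear)
next
  fix c x assume "x \<in> range (P \<nu> ^^ n)"
  then obtain u where "x = (P \<nu> ^^ n) u" by blast
  then show "c *\<^sub>C x \<in> range (P \<nu> ^^ n)"
    by (intro range_eqI[of _ _ "c *\<^sub>C u"]) (simp add: P_power_linear)
qed

lemma range_P_power_Suc: "range (P \<nu> ^^ Suc n) = P \<nu> ` range (P \<nu> ^^ n)"
  by (simp add: image_comp)

lemma decseq_range_P_power: "decseq (\<lambda>n. range (P \<nu> ^^ n))"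
proof (rule decseq_SucI, rule subsetI)
  fix n x assume "x \<in> range (P \<nu> ^^ Suc n)"
  then obtain z where "x = (P \<nu> ^^ n) (P \<nu> z)" by (auto simp: funpow_swap1)
  then show "x \<in> range (P \<nu> ^^ n)" by blast
qed

lemma P_maps_range: "x \<in> range (P \<nu> ^^ n) \<Longrightarrow> P \<mu> x \<in> range (P \<nu> ^^ n)"
  by (elim rangeE) (simp only: P_power_P[symmetric] rangeI)

lemma A_maps_range: "x \<in> range (P \<nu> ^^ n) \<Longrightarrow> A x \<in> range (P \<nu> ^^ n)"
  by (elim rangeE) (simp only: P_power_A[symmetric] rangeI)

lemma surj_on_range:
  assumes "surj (P \<mu>)" "y \<in> range (P \<nu> ^^ n)"
  obtains x where "x \<in> range (P \<nu> ^^ n)" "P \<mu> x = y"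
proof -
  obtain z where z: "y = (P \<nu> ^^ n) z" using assms(2) by blast
  obtain w where w: "z = P \<mu> w" using assms(1) by blast
  show ?thesis by (rule that[of "(P \<nu> ^^ n) w"]) (simp_all add: z w P_power_P)
qed

lemma subspace_kernel_on_range:
  "complex_vector.subspace {x \<in> range (P \<nu> ^^ n). P \<nu> x = 0}"
  unfolding Collect_conj_eq Collect_mem_eq
  by (rule complex_vector.subspace_inter[OF subspace_range_P_power])
    (simp add: complex_vector.subspace_def P_linear)

text \<open>Applying \<open>P \<nu>\<close> carries a decomposition of one range to the next; the
  images of \<open>B\<close> span the new complementary part.\<close>

lemma finite_codimensional_range_Suc:
  assumes "finite_codimensional_in (range (P \<nu> ^^ n)) (range (P \<nu> ^^ Suc n))"
  shows "finite_codimensional_in (range (P \<nu> ^^ Suc n)) (range (P \<nu> ^^ Suc (Suc n)))"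
proof -
  let ?Y = "range (P \<nu> ^^ n)" and ?Z = "range (P \<nu> ^^ Suc n)" and ?W = "range (P \<nu> ^^ Suc (Suc n))"
  obtain B where B: "finite B" "B \<subseteq> ?Y" "?Y = {m + b |m b. m \<in> ?Z \<and> b \<in> complex_vector.span B}"
    using assms unfolding finite_codimensional_in_def by blast
  have sub: "complex_vector.subspace ?Z" by (rule subspace_range_P_power)
  have PB: "P \<nu> ` B \<subseteq> ?Z"
    using B(2) unfolding range_P_power_Suc by (rule image_mono)
  have span_image: "P \<nu> b \<in> complex_vector.span (P \<nu> ` B)" if "b \<in> complex_vector.span B" for b
    using that
  proof (induction rule: complex_vector.span_induct_alt)
    case base
    then show ?case by (simp add: P_linear complex_vector.span_zero)
  next
    case (step c x y)
    then show ?case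
      by (simp add: P_linear complex_vector.span_add complex_vector.span_scale complex_vector.span_base)
  qed
  have "?Z = {m + b |m b. m \<in> ?W \<and> b \<in> complex_vector.span (P \<nu> ` B)}" (is "_ = ?R")
  proof
    show "?Z \<subseteq> ?R"
    proof
      fix y assume "y \<in> ?Z"
      then obtain x where "x \<in> ?Y" "y = P \<nu> x" unfolding range_P_power_Suc by blast
      moreover from this obtain m b where "m \<in> ?Z" "b \<in> complex_vector.span B" "x = m + b"
        using B(3) by blast
      ultimately have "y = P \<nu> m + P \<nu> b" "P \<nu> m \<in> ?W" "P \<nu> b \<in> complex_vector.span (P \<nu> ` B)"
        using span_image range_P_power_Suc[of "Suc n" \<nu>] by (simp_all add: P_linear)
      then show "y \<in> ?R" by blast
    qed
    have "?W \<subseteq> ?Z" using decseq_range_P_power decseq_SucD by blast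
    moreover have "complex_vector.span (P \<nu> ` B) \<subseteq> ?Z"
      by (rule complex_vector.span_minimal[OF PB sub])
    ultimately show "?R \<subseteq> ?Z"
      using complex_vector.subspace_add[OF sub] by blast
  qed
  then show ?thesis
    unfolding finite_codimensional_in_def using B(1) PB by (intro exI[of _ "P \<nu> ` B"]) simp
qed

text \<open>Closedness passes to the next range only together with finite codimension, so the
  induction carries both.\<close>

lemma closed_range_P_power:
  assumes "closed (range (P \<nu> ^^ n))"
    and "finite_codimensional_in (range (P \<nu> ^^ n)) (range (P \<nu> ^^ Suc n))"
  shows "closed (range (P \<nu> ^^ (n + k)))"
proof -
  have "closed (range (P \<nu> ^^ (n + k))) \<and>
    finite_codimensional_in (range (P \<nu> ^^ (n + k))) (range (P \<nu> ^^ Suc (n + k)))"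
  proof (induction k)
    case 0
    then show ?case using assms by simp
  next
    case (Suc k)
    let ?Y = "range (P \<nu> ^^ (n + k))"
    have "closed (P \<nu> ` ?Y)"
    proof (rule closed_range_of_finite_codimension[OF bounded_linear_P])
      show "subspace ?Y" by (rule subspace_of_complex_subspace[OF subspace_range_P_power])
      show "complex_vector.subspace (P \<nu> ` ?Y)"
        using subspace_range_P_power[of "Suc (n + k)" \<nu>] unfolding range_P_power_Suc .
      show "finite_codimensional_in ?Y (P \<nu> ` ?Y)"
        using Suc unfolding range_P_power_Suc by blast
    qed (use Suc in blast)+
    then show ?case
      using finite_codimensional_range_Suc[of "n + k" \<nu>] Suc by (simp only: range_P_power_Suc add_Suc_right)
  qed
  then show ?thesis ..
qed

section \<open>Kernels and ranges at different parameters\<close>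

text \<open>By induction \<open>P \<nu> x = P \<mu> w\<close> for some \<open>w\<close>; then
  \<open>P_combination\<close> exhibits a nonzero multiple of \<open>x\<close> as a value of
  \<open>P \<mu>\<close>.\<close>

lemma kernel_power_in_range:
  assumes "\<mu> \<noteq> \<nu>" "(P \<nu> ^^ k) x = 0"
  shows "x \<in> range (P \<mu>)"
  using assms(2)
proof (induction k arbitrary: x)
  case 0
  then show ?case using P_linear(1) by (metis funpow_0 rangeI)
next
  case (Suc k)
  then have "(P \<nu> ^^ k) (P \<nu> x) = 0" by (simp add: funpow_swap1)
  then obtain w where w: "P \<nu> x = P \<mu> w" using Suc.IH by blast
  have "(\<mu> - \<nu>) *\<^sub>C x = P \<mu> (\<mu> *\<^sub>C w - \<nu> *\<^sub>C x)"
    by (simp add: P_combination w P_linear)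
  then have "(1 / (\<mu> - \<nu>)) *\<^sub>C (\<mu> - \<nu>) *\<^sub>C x = P \<mu> ((1 / (\<mu> - \<nu>)) *\<^sub>C (\<mu> *\<^sub>C w - \<nu> *\<^sub>C x))"
    by (simp add: P_linear)
  moreover have "(1 / (\<mu> - \<nu>)) *\<^sub>C (\<mu> - \<nu>) *\<^sub>C x = x"
    using assms(1) by (simp add: scaleC_scaleC scaleC_one)
  ultimately show ?case by (metis rangeI)
qed

text \<open>On the kernel of \<open>P \<mu>\<close> the operator \<open>P \<nu>\<close> is
  multiplication by the nonzero scalar \<open>(\<mu> - \<nu>) / \<mu>\<close>. For
  \<open>\<mu> = 0\<close> this kernel is trivial, as \<open>P 0\<close> is the identity.\<close>

lemma kernel_in_range_power:
  assumes "\<mu> \<noteq> \<nu>" "P \<mu> x = 0"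
  shows "x \<in> range (P \<nu> ^^ k)"
proof (cases "\<mu> = 0")
  case True
  then have "x = 0" using assms(2) by (simp add: P_def)
  then show ?thesis using P_power_linear(1) by (metis rangeI)
next
  case False
  define c where "c = (\<mu> - \<nu>) / \<mu>"
  have "c \<noteq> 0" using False assms(1) by (simp add: c_def)
  have "(\<mu> - \<nu>) *\<^sub>C x = \<mu> *\<^sub>C P \<nu> x"
    using P_combination[of \<mu> \<nu> x] assms(2) by simp
  then have "(1 / \<mu>) *\<^sub>C (\<mu> - \<nu>) *\<^sub>C x = (1 / \<mu>) *\<^sub>C \<mu> *\<^sub>C P \<nu> x" by simp
  then have "P \<nu> x = c *\<^sub>C x" using False by (simp add: scaleC_scaleC scaleC_one c_def)
  then have "(P \<nu> ^^ k) x = c ^ k *\<^sub>C x"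
    by (induction k) (simp_all add: P_linear scaleC_scaleC scaleC_one mult.commute)
  then have "(P \<nu> ^^ k) ((1 / c ^ k) *\<^sub>C x) = x"
    using \<open>c \<noteq> 0\<close> by (simp add: P_power_linear scaleC_scaleC scaleC_one)
  then show ?thesis by (metis rangeI)
qed

section \<open>Local analysis at a B-Fredholm point\<close>

lemma norm_shift_le:
  assumes "\<And>x. norm (A x) \<le> norm x * a"
  shows "norm ((\<mu> - \<nu>) *\<^sub>C A x) \<le> (dist \<mu> \<nu> * a) * norm x"
  using mult_left_mono[OF assms[of x], of "dist \<mu> \<nu>"] by (simp add: norm_scaleC dist_norm mult_ac)

lemma bounded_linear_shift: "bounded_linear (\<lambda>x. c *\<^sub>C A x)"
  by (rule bounded_linear_compose[OF bounded_linear_scaleC_right A])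

text \<open>The intersection \<open>M\<close> of the ranges is closed, contains the stable kernel
  \<open>K m\<close> and is mapped onto itself by \<open>P \<nu>\<close>. Since \<open>acc\<close>
  supplies injective \<open>P \<mu>\<close> arbitrarily close,
  \<open>injective_of_injective_perturbations\<close> on \<open>M\<close> shows that this kernel is
  zero.\<close>

lemma injective_on_range_P_power:
  assumes cl: "closed (range (P \<nu> ^^ n))"
    and ker: "finite_dimensional {x \<in> range (P \<nu> ^^ n). P \<nu> x = 0}"
    and coker: "finite_codimensional_in (range (P \<nu> ^^ n)) (range (P \<nu> ^^ Suc n))"
    and acc: "\<nu> \<in> closure {\<mu>. bij (P \<mu>)}"
  obtains m where "n \<le> m" "\<And>x. x \<in> range (P \<nu> ^^ m) \<Longrightarrow> P \<nu> x = 0 \<Longrightarrow> x = 0"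
proof -
  define K where "K k = {x \<in> range (P \<nu> ^^ (n + k)). P \<nu> x = 0}" for k
  have dec: "range (P \<nu> ^^ j) \<subseteq> range (P \<nu> ^^ i)" if "i \<le> j" for i j
    using decseqD[OF decseq_range_P_power that] .
  obtain m where m: "\<And>k. m \<le> k \<Longrightarrow> K k = K m"
  proof (rule finite_dimensional_chain_stable)
    show "complex_vector.subspace (K k)" for k
      unfolding K_def by (rule subspace_kernel_on_range)
    show "decseq K"
      unfolding decseq_def
    proof (intro allI impI subsetI)
      fix i j x assume "i \<le> j" "x \<in> K j"
      then show "x \<in> K i" using dec[of "n + i" "n + j"] by (auto simp: K_def)
    qed
    show "finite_dimensional (K 0)" using ker by (simp add: K_def)
  qed (rule that)
  \<comment> \<open>Stability of the kernels makes \<open>P \<nu>\<close> surjective on the intersection \<open>M\<close> of the ranges: two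
    preimages of the same vector differ by an element of \<open>K m \<subseteq> M\<close>.\<close>
  define M where "M = (\<Inter>k. range (P \<nu> ^^ (n + k)))"
  have M_iff: "x \<in> M \<longleftrightarrow> (\<forall>k. x \<in> range (P \<nu> ^^ (n + k)))" for x
    by (simp only: M_def INT_iff ball_UNIV)
  have M_sub: "complex_vector.subspace M"
    unfolding M_def by (intro complex_vector.subspace_Inter ballI) (auto intro: subspace_range_P_power)
  have M_closed: "closed M"
    unfolding M_def by (intro closed_INT ballI closed_range_P_power cl coker)
  \<comment> \<open>Being equal to all later kernels, \<open>K m\<close> lies in all later ranges;
    the earlier ranges are larger anyway.\<close>
  have K_sub: "K m \<subseteq> M"
  proof
    fix x assume x: "x \<in> K m"
    have "x \<in> range (P \<nu> ^^ (n + k))" for k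
      using x m[of k] dec[of "n + k" "n + m"] by (cases "m \<le> k") (auto simp: K_def)
    then show "x \<in> M" unfolding M_iff by (rule allI)
  qed
  have P_M: "P \<mu> ` M \<subseteq> M" for \<mu>
  proof (rule image_subsetI)
    fix x assume "x \<in> M"
    then show "P \<mu> x \<in> M" unfolding M_iff by (intro allI P_maps_range) (rule spec)
  qed
  have A_M: "A x \<in> M" if "x \<in> M" for x
    using that unfolding M_iff by (intro allI A_maps_range) (rule spec)
  have "M \<subseteq> P \<nu> ` M"
  proof
    fix y assume "y \<in> M"
    have "\<exists>x. x \<in> range (P \<nu> ^^ (n + k)) \<and> P \<nu> x = y" for k
    proof -
      have "y \<in> range (P \<nu> ^^ (n + Suc k))" using \<open>y \<in> M\<close> unfolding M_iff by (rule spec)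
      then have "y \<in> P \<nu> ` range (P \<nu> ^^ (n + k))" by (simp only: add_Suc_right range_P_power_Suc)
      then show ?thesis by (rule imageE) blast
    qed
    then obtain x where x: "\<And>k. x k \<in> range (P \<nu> ^^ (n + k))" "\<And>k. P \<nu> (x k) = y"
      using choice[of "\<lambda>k x. x \<in> range (P \<nu> ^^ (n + k)) \<and> P \<nu> x = y"] by blast
    have "x m \<in> range (P \<nu> ^^ (n + k))" for k
    proof (cases "m \<le> k")
      case True
      have "x k \<in> range (P \<nu> ^^ (n + m))" using x(1)[of k] dec[of "n + m" "n + k"] True by auto
      then have "x m - x k \<in> K m"
        using x complex_vector.subspace_diff[OF subspace_range_P_power x(1)[of m]]
        by (simp add: K_def P_linear)
      then have "x m - x k \<in> range (P \<nu> ^^ (n + k))" using m[OF True] by (auto simp: K_def)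
      then have "(x m - x k) + x k \<in> range (P \<nu> ^^ (n + k))"
        by (intro complex_vector.subspace_add subspace_range_P_power x(1))
      then show ?thesis by (simp only: diff_add_cancel)
    next
      case False
      then show ?thesis using x(1)[of m] dec[of "n + k" "n + m"] by auto
    qed
    then have "x m \<in> M" unfolding M_iff by (rule allI)
    then show "y \<in> P \<nu> ` M" by (rule rev_image_eqI) (simp add: x(2))
  qed
  then have PM_eq: "P \<nu> ` M = M" by (intro subset_antisym P_M)
  obtain C where C: "C > 0" "\<And>y. y \<in> P \<nu> ` M \<Longrightarrow> \<exists>x\<in>M. P \<nu> x = y \<and> norm x \<le> C * norm y"
    by (rule open_mapping_on[OF bounded_linear_P[of \<nu>] subspace_of_complex_subspace[OF M_sub] M_closed])
      (simp add: PM_eq M_closed, rule that)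
  obtain a where a: "a > 0" "\<And>x. norm (A x) \<le> norm x * a"
    using A.pos_bounded by blast
  \<comment> \<open>This radius gives \<open>C * (dist \<mu> \<nu> * a) < 1 / 2\<close>, the
    smallness needed for the perturbation.\<close>
  have "1 / (2 * C * a) > 0" using C a by simp
  then obtain \<mu> where \<mu>: "bij (P \<mu>)" "dist \<mu> \<nu> < 1 / (2 * C * a)"
    using acc unfolding closure_approachable by blast
  show ?thesis
  proof (rule that[of "n + m"])
    fix x assume "x \<in> range (P \<nu> ^^ (n + m))" and x: "P \<nu> x = 0"
    then have "x \<in> M" using K_sub by (auto simp: K_def)
    show "x = 0"
    proof (rule injective_of_injective_perturbations[OF bounded_linear_P[of \<nu>]
          bounded_linear_shift[of "\<mu> - \<nu>"] subspace_of_complex_subspace[OF M_sub] M_closed P_M])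
      show "(\<lambda>x. (\<mu> - \<nu>) *\<^sub>C A x) ` M \<subseteq> M"
        by (intro image_subsetI complex_vector.subspace_scale[OF M_sub] A_M)
      show "0 \<le> C" using C by simp
      show "\<exists>x\<in>M. P \<nu> x = y \<and> norm x \<le> C * norm y" if "y \<in> M" for y
        using C(2) that PM_eq by simp
      show "norm ((\<mu> - \<nu>) *\<^sub>C A x) \<le> (dist \<mu> \<nu> * a) * norm x" for x
        by (rule norm_shift_le[OF a(2)])
      show "0 \<le> dist \<mu> \<nu> * a" using a by simp
      show "C * (dist \<mu> \<nu> * a) < 1 / 2" using \<mu>(2) C a by (simp add: field_simps)
      show "x = 0" if "P \<nu> x - (\<mu> - \<nu>) *\<^sub>C A x = 0" for x
      proof -
        have "P \<mu> x = P \<mu> 0" using that P_shift[of \<mu> x \<nu>] by (simp add: P_linear)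
        then show ?thesis using \<mu>(1) by (simp add: bij_is_inj inj_eq)
      qed
    qed fact+
  qed simp
qed

text \<open>On a range \<open>M\<close> where \<open>P \<nu>\<close> is injective with closed image,
  it is bounded below, and so is \<open>P \<mu>\<close>, uniformly for \<open>\<mu>\<close> near
  \<open>\<nu>\<close>. Solutions for nearby bijective \<open>P \<mu>\<close> show that
  \<open>P \<nu>\<close> maps \<open>M\<close> onto itself; coprimality extends bijectivity of
  \<open>P \<mu>\<close> from \<open>M\<close> to the whole space.\<close>

lemma B_Fredholm_point:
  assumes cl: "closed (range (P \<nu> ^^ n))"
    and ker: "finite_dimensional {x \<in> range (P \<nu> ^^ n). P \<nu> x = 0}"
    and coker: "finite_codimensional_in (range (P \<nu> ^^ n)) (range (P \<nu> ^^ Suc n))"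
    and acc: "\<nu> \<in> closure {\<mu>. bij (P \<mu>)}"
  obtains m \<epsilon> where "\<And>x. (P \<nu> ^^ Suc m) x = 0 \<Longrightarrow> (P \<nu> ^^ m) x = 0"
    "range (P \<nu> ^^ Suc m) = range (P \<nu> ^^ m)"
    "\<epsilon> > 0" "\<And>\<mu>. \<mu> \<noteq> \<nu> \<Longrightarrow> dist \<mu> \<nu> < \<epsilon> \<Longrightarrow> bij (P \<mu>)"
proof -
  obtain m where "n \<le> m" and inj: "\<And>x. x \<in> range (P \<nu> ^^ m) \<Longrightarrow> P \<nu> x = 0 \<Longrightarrow> x = 0"
    using injective_on_range_P_power[OF assms] by blast
  then obtain k where k: "m = n + k" using le_Suc_ex by blast
  define M where "M = range (P \<nu> ^^ m)"
  have M_sub: "complex_vector.subspace M" unfolding M_def by (rule subspace_range_P_power)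
  have M_closed: "closed M" unfolding M_def k by (rule closed_range_P_power[OF cl coker])
  have PM_closed: "closed (P \<nu> ` M)"
    using closed_range_P_power[OF cl coker, of "Suc k"] unfolding M_def k
    by (simp only: range_P_power_Suc[symmetric] add_Suc_right)
  have P_M: "P \<mu> ` M \<subseteq> M" for \<mu> unfolding M_def by (intro image_subsetI P_maps_range)
  obtain C where C: "C > 0" "\<And>y. y \<in> P \<nu> ` M \<Longrightarrow> \<exists>x\<in>M. P \<nu> x = y \<and> norm x \<le> C * norm y"
    by (rule open_mapping_on[OF bounded_linear_P[of \<nu>] subspace_of_complex_subspace[OF M_sub]
          M_closed PM_closed]) (rule that)
  have below: "norm x \<le> C * norm (P \<nu> x)" if x: "x \<in> M" for x
  proof -
    obtain x' where x': "x' \<in> M" "P \<nu> x' = P \<nu> x" "norm x' \<le> C * norm (P \<nu> x)"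
      using C(2)[of "P \<nu> x"] x by blast
    have "x' - x \<in> M" "P \<nu> (x' - x) = 0"
      using x x' complex_vector.subspace_diff[OF M_sub] by (simp_all add: P_linear)
    then have "x' - x = 0" unfolding M_def by (rule inj)
    then show ?thesis using x' by simp
  qed
  obtain a where a: "a > 0" "\<And>x. norm (A x) \<le> norm x * a"
    using A.pos_bounded by blast
  define \<epsilon> where "\<epsilon> = 1 / (2 * C * a)"
  have "\<epsilon> > 0" using C a by (simp add: \<epsilon>_def)
  have small: "C * (dist \<mu> \<nu> * a) \<le> 1 / 2" if "dist \<mu> \<nu> < \<epsilon>" for \<mu>
    using that C(1) a(1) by (simp add: \<epsilon>_def field_simps)
  \<comment> \<open>The perturbation contributes at most half of \<open>norm x\<close>; absorbing it
    doubles the constant.\<close>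
  have bound: "norm x \<le> 2 * C * norm (P \<mu> x)" if "x \<in> M" "dist \<mu> \<nu> < \<epsilon>" for x \<mu>
  proof -
    have "norm (P \<nu> x) \<le> norm (P \<mu> x) + norm ((\<mu> - \<nu>) *\<^sub>C A x)"
      unfolding P_shift[of \<mu> x \<nu>] using norm_triangle_sub by (metis add.commute)
    also have "\<dots> \<le> norm (P \<mu> x) + (dist \<mu> \<nu> * a) * norm x"
      using norm_shift_le[OF a(2)] by simp
    finally have "C * norm (P \<nu> x) \<le> C * (norm (P \<mu> x) + (dist \<mu> \<nu> * a) * norm x)"
      using C(1) by simp
    also have "\<dots> = C * norm (P \<mu> x) + (C * (dist \<mu> \<nu> * a)) * norm x"
      by (simp add: algebra_simps)
    also have "\<dots> \<le> C * norm (P \<mu> x) + (1 / 2) * norm x"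
      using small[OF that(2)] by (intro add_left_mono mult_right_mono) auto
    finally show ?thesis using below[OF that(1)] by simp
  qed
  have PM_eq: "P \<nu> ` M = M"
  proof
    show "M \<subseteq> P \<nu> ` M"
    proof
      fix y assume y: "y \<in> M"
      have "y \<in> closure (P \<nu> ` M)"
        unfolding closure_approachable
      proof (intro allI impI)
        fix e :: real assume "e > 0"
        \<comment> \<open>\<open>c\<close> bounds \<open>norm (A x)\<close> for the solution
          \<open>x\<close> of \<open>P \<mu> x = y\<close> chosen below; \<open>norm y + 1\<close>
          keeps it positive when \<open>y = 0\<close>.\<close>
        define c where "c = a * (2 * C * (norm y + 1))"
        have "c > 0" using a C by (simp add: c_def add_nonneg_pos)
        then have "min \<epsilon> (e / c) > 0" using \<open>\<epsilon> > 0\<close> \<open>e > 0\<close> by simp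
        then obtain \<mu> where \<mu>: "bij (P \<mu>)" "dist \<mu> \<nu> < \<epsilon>" "dist \<mu> \<nu> < e / c"
          using acc unfolding closure_approachable by (metis (lifting) mem_Collect_eq min_less_iff_conj)
        obtain x where x: "x \<in> M" "P \<mu> x = y"
          using surj_on_range[of \<mu> y m \<nu>] bij_is_surj[OF \<mu>(1)] y unfolding M_def by blast
        have "dist (P \<nu> x) y = norm ((\<mu> - \<nu>) *\<^sub>C A x)"
          unfolding x(2)[symmetric] P_shift[of \<mu> x \<nu>] by (simp add: dist_norm)
        also have "\<dots> \<le> (dist \<mu> \<nu> * a) * norm x" by (rule norm_shift_le[OF a(2)])
        also have "\<dots> \<le> (dist \<mu> \<nu> * a) * (2 * C * (norm y + 1))"
        proof (rule mult_left_mono)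
          have "2 * C * norm y \<le> 2 * C * (norm y + 1)" using C(1) by (intro mult_left_mono) auto
          then show "norm x \<le> 2 * C * (norm y + 1)" using bound[OF x(1) \<mu>(2)] x(2) by simp
        qed (use a in simp)
        also have "\<dots> = dist \<mu> \<nu> * c" by (simp add: c_def)
        also have "\<dots> < e" using \<mu>(3) \<open>c > 0\<close> by (simp add: field_simps)
        finally show "\<exists>z\<in>P \<nu> ` M. dist z y < e" using x(1) by blast
      qed
      then show "y \<in> P \<nu> ` M" using PM_closed by simp
    qed
  qed (rule P_M)
  have bij: "bij (P \<mu>)" if ne: "\<mu> \<noteq> \<nu>" and near: "dist \<mu> \<nu> < \<epsilon>" for \<mu>
  proof (rule bijI)
    have "x = 0" if "P \<mu> x = 0" for x
    proof -
      have "x \<in> M" unfolding M_def using kernel_in_range_power[OF ne that] .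
      from bound[OF this near] show ?thesis using that by simp
    qed
    then show "inj (P \<mu>)"
      by (intro injI) (metis P_linear(3) right_minus_eq)
    have surj_M: "\<exists>x\<in>M. P \<mu> x = y" if "y \<in> M" for y
    proof -
      have "\<exists>x\<in>M. P \<nu> x - (\<mu> - \<nu>) *\<^sub>C A x = y \<and> norm x \<le> 2 * C * norm y"
      proof (rule surjective_perturbation[OF bounded_linear_P[of \<nu>]
          bounded_linear_shift[of "\<mu> - \<nu>"] subspace_of_complex_subspace[OF M_sub] M_closed P_M])
        show "(\<lambda>x. (\<mu> - \<nu>) *\<^sub>C A x) ` M \<subseteq> M"
          unfolding M_def
          by (intro image_subsetI complex_vector.subspace_scale[OF subspace_range_P_power] A_maps_range)
        show "0 \<le> C" using C by simp
        show "\<exists>x\<in>M. P \<nu> x = y \<and> norm x \<le> C * norm y" if "y \<in> M" for y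
          using C(2) that PM_eq by simp
        show "norm ((\<mu> - \<nu>) *\<^sub>C A x) \<le> (dist \<mu> \<nu> * a) * norm x" for x
          by (rule norm_shift_le[OF a(2)])
        show "0 \<le> dist \<mu> \<nu> * a" using a by simp
      qed (fact small[OF near] that)+
      then show ?thesis by (simp only: P_shift[symmetric]) blast
    qed
    show "surj (P \<mu>)"
    proof (rule surjI[of _ "\<lambda>y. SOME x. P \<mu> x = y"], rule someI_ex)
      fix y
      \<comment> \<open>The equation is first solved in \<open>M\<close> with right side
        \<open>(P \<nu> ^^ m) y\<close>. The defect \<open>y - P \<mu> z\<close> is then killed by
        \<open>P \<nu> ^^ m\<close>, hence lies in the range of \<open>P \<mu>\<close>.\<close>
      obtain x where "x \<in> M" and x: "P \<mu> x = (P \<nu> ^^ m) y" using surj_M[of "(P \<nu> ^^ m) y"] M_def by blast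
      then obtain z where z: "x = (P \<nu> ^^ m) z" unfolding M_def by blast
      have "(P \<nu> ^^ m) (y - P \<mu> z) = 0"
        using x by (simp add: P_power_linear P_power_P z)
      then obtain w where "y - P \<mu> z = P \<mu> w" using kernel_power_in_range[OF ne] by blast
      then have "y = P \<mu> (z + w)" by (simp add: P_linear algebra_simps)
      then show "\<exists>x. P \<mu> x = y" by blast
    qed
  qed
  show ?thesis
  proof (rule that[of m \<epsilon>])
    show "(P \<nu> ^^ m) x = 0" if "(P \<nu> ^^ Suc m) x = 0" for x
      using inj that by simp
    show "range (P \<nu> ^^ Suc m) = range (P \<nu> ^^ m)"
      unfolding range_P_power_Suc using PM_eq by (simp add: M_def)
  qed (use \<open>\<epsilon> > 0\<close> bij in auto)
qed

section \<open>Consequences of finite ascent and descent\<close>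

text \<open>For \<open>n = p + q\<close> both kernels and ranges have stabilised. Stable kernels
  make range and kernel of \<open>P \<nu> ^^ n\<close> meet trivially, stable ranges make their sum
  the whole space, so the kernel is a closed complement of the range.\<close>

lemma closed_range_of_finite_ascent_descent:
  assumes ker: "\<And>x. (P \<nu> ^^ Suc p) x = 0 \<Longrightarrow> (P \<nu> ^^ p) x = 0"
    and ran: "range (P \<nu> ^^ Suc q) = range (P \<nu> ^^ q)"
  obtains n where "closed (range (P \<nu> ^^ n))" "range (P \<nu> ^^ Suc n) = range (P \<nu> ^^ n)"
    "\<And>x. x \<in> range (P \<nu> ^^ n) \<Longrightarrow> P \<nu> x = 0 \<Longrightarrow> x = 0"
proof -
  have ker_p: "(P \<nu> ^^ p) x = 0" if "(P \<nu> ^^ (p + k)) x = 0" for k x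
    using that
  proof (induction k arbitrary: x)
    case (Suc k)
    then have "(P \<nu> ^^ (p + k)) (P \<nu> x) = 0" by (simp add: funpow_swap1)
    then have "(P \<nu> ^^ p) (P \<nu> x) = 0" by (rule Suc.IH)
    then have "(P \<nu> ^^ Suc p) x = 0" by (simp add: funpow_swap1)
    then show ?case by (rule ker)
  qed simp
  have ran_q: "range (P \<nu> ^^ (q + k)) = range (P \<nu> ^^ q)" for k
  proof (induction k)
    case (Suc k)
    have "range (P \<nu> ^^ (q + Suc k)) = P \<nu> ` range (P \<nu> ^^ (q + k))"
      by (simp only: add_Suc_right range_P_power_Suc)
    then show ?case using Suc ran by (simp only: range_P_power_Suc)
  qed simp
  define n where "n = p + q"
  have ker_n: "(P \<nu> ^^ n) x = 0" if "(P \<nu> ^^ (n + k)) x = 0" for x k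
  proof -
    have "(P \<nu> ^^ p) x = 0" using ker_p[of "q + k" x] that by (simp add: n_def add.assoc)
    then show ?thesis by (simp add: n_def add.commute[of p q] funpow_add P_power_linear)
  qed
  have ran_n: "range (P \<nu> ^^ (n + k)) = range (P \<nu> ^^ n)" for k
    using ran_q[of "p + k"] ran_q[of p] by (simp add: n_def add_ac)
  let ?f = "P \<nu> ^^ n"
  have "closed (range ?f)"
  proof (rule closed_range_of_closed_complement[OF bounded_linear_P_power subspace_UNIV closed_UNIV])
    show "subspace {x. ?f x = 0}"
      by (rule subspace_of_complex_subspace) (simp add: complex_vector.subspace_def P_power_linear)
    have "continuous_on UNIV ?f"
      by (rule linear_continuous_on[OF bounded_linear_P_power])
    then show "closed {x. ?f x = 0}"
      by (intro closed_Collect_eq continuous_on_const)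
    show "range ?f \<inter> {x. ?f x = 0} = {0}"
    proof
      have "?f z = 0" if "?f (?f z) = 0" for z
        using ker_n[of n z] that by (simp add: funpow_add)
      then show "range ?f \<inter> {x. ?f x = 0} \<subseteq> {0}" by auto
      show "{0} \<subseteq> range ?f \<inter> {x. ?f x = 0}"
        using P_power_linear(1)[of n \<nu>] by (metis (mono_tags) IntI empty_subsetI insert_subset mem_Collect_eq rangeI)
    qed
    have "x \<in> {u + v |u v. u \<in> range ?f \<and> v \<in> {x. ?f x = 0}}" for x
    proof -
      have "?f x \<in> range (P \<nu> ^^ (n + n))" using ran_n[of n] by blast
      then obtain z where "?f x = ?f (?f z)" by (auto simp: funpow_add)
      then have "x = ?f z + (x - ?f z)" "?f (x - ?f z) = 0" by (simp_all add: P_power_linear)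
      then show ?thesis by blast
    qed
    then have "{u + v |u v. u \<in> range ?f \<and> v \<in> {x. ?f x = 0}} = UNIV" by blast
    then show "closed {u + v |u v. u \<in> range ?f \<and> v \<in> {x. ?f x = 0}}" by simp
  qed
  moreover have "range (P \<nu> ^^ Suc n) = range ?f" using ran_n[of 1] by simp
  moreover have "x = 0" if x: "x \<in> range ?f" "P \<nu> x = 0" for x
  proof -
    obtain z where z: "x = ?f z" using x by blast
    have "(P \<nu> ^^ (n + 1)) z = 0" using x z by simp
    then show ?thesis using ker_n z by blast
  qed
  ultimately show ?thesis by (rule that)
qed

end

section \<open>The operators \<open>(I - \<nu>A)A\<inverse>\<close>\<close>

lemma Inf_enat_finite_iff: "Inf {enat n |n. Q n} \<noteq> \<infinity> \<longleftrightarrow> (\<exists>n. Q n)"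
proof
  assume "\<exists>n. Q n"
  then obtain n where "enat n \<in> {enat n |n. Q n}" by blast
  from Inf_lower[OF this] show "Inf {enat n |n. Q n} \<noteq> \<infinity>"
    by (intro notI) simp
next
  assume "Inf {enat n |n. Q n} \<noteq> \<infinity>"
  then show "\<exists>n. Q n" by (rule contrapos_np) (simp add: Inf_enat_def)
qed

locale injective_pencil = bounded_pencil +
  assumes inj_A: "inj A"
begin

section \<open>Powers, ranges and nullspaces of \<open>pencil_op\<close>\<close>

definition pencil_op :: "complex \<Rightarrow> ('a \<rightharpoonup> 'a)" where
  "pencil_op \<nu> x = (if x \<in> range A then Some (P \<nu> (inv A x)) else None)"

lemma pencil_op_iff: "pencil_op \<nu> x = Some y \<longleftrightarrow> (\<exists>z. x = A z \<and> y = P \<nu> z)"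
proof
  assume "pencil_op \<nu> x = Some y"
  then have "x \<in> range A" "y = P \<nu> (inv A x)" by (simp_all add: pencil_op_def split: if_splits)
  then show "\<exists>z. x = A z \<and> y = P \<nu> z" by (intro exI[of _ "inv A x"]) (simp add: f_inv_into_f)
next
  assume "\<exists>z. x = A z \<and> y = P \<nu> z"
  then show "pencil_op \<nu> x = Some y" by (elim exE conjE) (simp add: pencil_op_def inv_f_f[OF inj_A])
qed

lemma A_eq_iff: "A x = A y \<longleftrightarrow> x = y"
  using inj_A by (simp add: inj_eq)

text \<open>\<open>P \<nu>\<close> is the identity modulo the range of \<open>A\<close>, hence so
  are its powers.\<close>

lemma diff_P_power_in_range: "x - (P \<nu> ^^ n) x \<in> range A"
proof (induction n)
  case 0
  show ?case by (rule range_eqI[of _ _ 0]) (simp add: A.zero)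
next
  case (Suc n)
  then obtain w where w: "x - (P \<nu> ^^ n) x = A w" by blast
  have "x - (P \<nu> ^^ Suc n) x = A (w + \<nu> *\<^sub>C (P \<nu> ^^ n) x)"
    by (simp add: P_def A.add A_scaleC flip: w)
  then show ?case by blast
qed

text \<open>A vector sent into the range of \<open>A\<close> by a power of \<open>P \<nu>\<close>
  was already there, and \<open>A\<close> can be cancelled. This controls the natural domains of the
  powers of \<open>pencil_op\<close>.\<close>

lemma P_power_in_range_A: "(P \<nu> ^^ n) z = A w \<Longrightarrow> \<exists>u. z = A u \<and> w = (P \<nu> ^^ n) u"
proof -
  assume w: "(P \<nu> ^^ n) z = A w"
  obtain v where "z - (P \<nu> ^^ n) z = A v" using diff_P_power_in_range by blast
  then have z: "z = A (v + w)" by (simp add: w A.add algebra_simps)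
  have "A ((P \<nu> ^^ n) (v + w)) = A w" using w by (simp only: z P_power_A)
  then show ?thesis using z by (auto simp: A_eq_iff)
qed

text \<open>Each composition demands that \<open>(P \<nu> ^^ n) z\<close> lie in the range of
  \<open>A\<close>; by \<open>P_power_in_range_A\<close> this just splits off one more factor
  \<open>A\<close> from \<open>z\<close>.\<close>

lemma op_power_pencil_op:
  "op_power (pencil_op \<nu>) n x = Some y \<longleftrightarrow> (\<exists>z. x = (A ^^ n) z \<and> y = (P \<nu> ^^ n) z)"
proof (induction n arbitrary: y)
  case (Suc n)
  have "op_power (pencil_op \<nu>) (Suc n) x = Some y \<longleftrightarrow>
      (\<exists>u. op_power (pencil_op \<nu>) n x = Some u \<and> pencil_op \<nu> u = Some y)"
    by (simp add: map_comp_Some_iff)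
  also have "\<dots> \<longleftrightarrow> (\<exists>z w. x = (A ^^ n) z \<and> (P \<nu> ^^ n) z = A w \<and> y = P \<nu> w)"
    unfolding Suc pencil_op_iff by blast
  also have "\<dots> \<longleftrightarrow> (\<exists>u. x = (A ^^ Suc n) u \<and> y = (P \<nu> ^^ Suc n) u)"
  proof
    assume "\<exists>z w. x = (A ^^ n) z \<and> (P \<nu> ^^ n) z = A w \<and> y = P \<nu> w"
    then obtain z w where *: "x = (A ^^ n) z" "(P \<nu> ^^ n) z = A w" "y = P \<nu> w" by blast
    then obtain u where "z = A u" "w = (P \<nu> ^^ n) u" using P_power_in_range_A by blast
    then show "\<exists>u. x = (A ^^ Suc n) u \<and> y = (P \<nu> ^^ Suc n) u"
      using * by (intro exI[of _ u]) (simp add: funpow_swap1)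
  next
    assume "\<exists>u. x = (A ^^ Suc n) u \<and> y = (P \<nu> ^^ Suc n) u"
    then obtain u where "x = (A ^^ n) (A u)" "y = P \<nu> ((P \<nu> ^^ n) u)"
      by (auto simp: funpow_swap1)
    then show "\<exists>z w. x = (A ^^ n) z \<and> (P \<nu> ^^ n) z = A w \<and> y = P \<nu> w"
      using P_power_A by blast
  qed
  finally show ?case .
qed auto

lemma ran_op_power: "ran (op_power (pencil_op \<nu>) n) = range (P \<nu> ^^ n)"
  by (auto simp: ran_def op_power_pencil_op)

text \<open>Since 0 is \<open>A 0\<close>, a kernel vector is \<open>A u\<close> with
  \<open>u\<close> again in the kernel. Repetition puts the kernel into the domain of every
  power.\<close>

lemma kernel_P_power_in_range_A:
  "(P \<nu> ^^ n) x = 0 \<Longrightarrow> \<exists>z. x = (A ^^ k) z \<and> (P \<nu> ^^ n) z = 0"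
proof (induction k)
  case (Suc k)
  then obtain z where z: "x = (A ^^ k) z" "(P \<nu> ^^ n) z = 0" by blast
  then obtain u where "z = A u" "0 = (P \<nu> ^^ n) u"
    using P_power_in_range_A[of n \<nu> z 0] by (auto simp: A.zero)
  then show ?case using z(1) by (intro exI[of _ u]) (simp add: funpow_swap1)
qed auto

lemma nullspace_op_power: "nullspace (op_power (pencil_op \<nu>) n) = {x. (P \<nu> ^^ n) x = 0}"
proof -
  have A_pow: "(P \<nu> ^^ n) ((A ^^ k) z) = (A ^^ k) ((P \<nu> ^^ n) z)" "(A ^^ k) 0 = 0" for k z
    by (induction k) (simp_all add: P_power_A A.zero)
  show ?thesis
    unfolding nullspace_def op_power_pencil_op
  proof (intro Collect_cong iffI)
    fix x assume "\<exists>z. x = (A ^^ n) z \<and> 0 = (P \<nu> ^^ n) z"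
    then show "(P \<nu> ^^ n) x = 0" by (auto simp: A_pow)
  next
    fix x assume "(P \<nu> ^^ n) x = 0"
    from kernel_P_power_in_range_A[OF this, of n]
    show "\<exists>z. x = (A ^^ n) z \<and> 0 = (P \<nu> ^^ n) z" by auto
  qed
qed

section \<open>Closedness and the B-Fredholm property of \<open>pencil_op\<close>\<close>

lemma linear_operator_restrict:
  assumes "complex_vector.subspace Y"
  shows "linear_operator (pencil_op \<nu> |` Y)"
proof -
  have iff: "(pencil_op \<nu> |` Y) x = Some y \<longleftrightarrow> x \<in> Y \<and> (\<exists>z. x = A z \<and> y = P \<nu> z)" for x y
    by (simp add: restrict_map_def pencil_op_iff)
  have add: "(pencil_op \<nu> |` Y) (x + y) = Some (u + v)"
    if "(pencil_op \<nu> |` Y) x = Some u" "(pencil_op \<nu> |` Y) y = Some v" for x y u v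
    using that complex_vector.subspace_add[OF assms]
    unfolding iff by (metis A.add P_linear(2))
  have scale: "(pencil_op \<nu> |` Y) (c *\<^sub>C x) = Some (c *\<^sub>C u)"
    if "(pencil_op \<nu> |` Y) x = Some u" for c x u
    using that complex_vector.subspace_scale[OF assms]
    unfolding iff by (metis A_scaleC P_linear(4))
  have zero: "(pencil_op \<nu> |` Y) 0 = Some 0"
    using complex_vector.subspace_0[OF assms]
    unfolding iff by (metis A.zero P_linear(1))
  have "complex_vector.subspace (dom (pencil_op \<nu> |` Y))"
  proof (rule complex_vector.subspaceI)
    show "0 \<in> dom (pencil_op \<nu> |` Y)" using zero by (rule domI)
    show "x + y \<in> dom (pencil_op \<nu> |` Y)"
      if "x \<in> dom (pencil_op \<nu> |` Y)" "y \<in> dom (pencil_op \<nu> |` Y)" for x y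
      using that add by (meson domD domI)
    show "c *\<^sub>C x \<in> dom (pencil_op \<nu> |` Y)" if "x \<in> dom (pencil_op \<nu> |` Y)" for c x
      using that scale by (meson domD domI)
  qed
  then show ?thesis
    unfolding linear_operator_def using add scale by blast
qed

text \<open>From \<open>x = A z\<close> and \<open>y = P \<nu> z\<close> follows
  \<open>z = y + \<nu> *\<^sub>C x\<close>, so the graph is cut out by the continuous equation
  \<open>A (y + \<nu> *\<^sub>C x) = x\<close> and by \<open>x \<in> Y\<close>.\<close>

lemma closed_operator_restrict:
  assumes "complex_vector.subspace Y" "closed Y"
  shows "closed_operator (pencil_op \<nu> |` Y)"
proof -
  have "Map.graph (pencil_op \<nu> |` Y) = {p. A (snd p + \<nu> *\<^sub>C fst p) = fst p} \<inter> (Y \<times> UNIV)"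
  proof (intro set_eqI)
    fix p :: "'a \<times> 'a"
    obtain x y where p: "p = (x, y)" by fastforce
    have "(\<exists>z. x = A z \<and> y = P \<nu> z) \<longleftrightarrow> A (y + \<nu> *\<^sub>C x) = x"
      by (auto simp: P_def intro!: exI[of _ "y + \<nu> *\<^sub>C x"])
    then show "p \<in> Map.graph (pencil_op \<nu> |` Y) \<longleftrightarrow>
        p \<in> {p. A (snd p + \<nu> *\<^sub>C fst p) = fst p} \<inter> (Y \<times> UNIV)"
      by (auto simp: p graph_def restrict_map_def pencil_op_iff)
  qed
  moreover have "closed {p :: 'a \<times> 'a. A (snd p + \<nu> *\<^sub>C fst p) = fst p}"
    by (intro closed_Collect_eq A.continuous_on continuous_intros
        bounded_linear.continuous_on[OF bounded_linear_scaleC_right])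
  ultimately have "closed (Map.graph (pencil_op \<nu> |` Y))"
    using assms(2) by (simp add: closed_Int closed_Times)
  then show ?thesis
    unfolding closed_operator_def using linear_operator_restrict[OF assms(1)] by blast
qed

lemma closed_operator_pencil_op: "closed_operator (pencil_op \<nu>)"
proof -
  have "pencil_op \<nu> |` UNIV = pencil_op \<nu>" by (simp add: restrict_map_def)
  then show ?thesis using closed_operator_restrict[of UNIV \<nu>] by simp
qed

lemma B_Fredholm_pencil_op_iff:
  "B_Fredholm (pencil_op \<nu>) \<longleftrightarrow>
    (\<exists>n. closed (range (P \<nu> ^^ n)) \<and> finite_dimensional {x \<in> range (P \<nu> ^^ n). P \<nu> x = 0} \<and>
      finite_codimensional_in (range (P \<nu> ^^ n)) (range (P \<nu> ^^ Suc n)))"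
proof -
  have null: "nullspace (pencil_op \<nu> |` Y) = {x \<in> Y. P \<nu> x = 0}" for Y
  proof -
    have "pencil_op \<nu> x = Some 0 \<longleftrightarrow> P \<nu> x = 0" for x
      using nullspace_op_power[of \<nu> 1] by (auto simp: nullspace_def fun_eq_iff set_eq_iff)
    then show ?thesis by (auto simp: nullspace_def restrict_map_def)
  qed
  have ran: "ran (pencil_op \<nu> |` range (P \<nu> ^^ n)) = range (P \<nu> ^^ Suc n)" for n
  proof (intro set_eqI iffI)
    fix y assume "y \<in> ran (pencil_op \<nu> |` range (P \<nu> ^^ n))"
    then obtain x where "(pencil_op \<nu> |` range (P \<nu> ^^ n)) x = Some y" by (auto simp: ran_def)
    then have "x \<in> range (P \<nu> ^^ n)" "pencil_op \<nu> x = Some y"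
      by (simp_all add: restrict_map_def split: if_splits)
    then obtain v z where "x = (P \<nu> ^^ n) v" "x = A z" "y = P \<nu> z"
      unfolding pencil_op_iff by blast
    \<comment> \<open>As \<open>A z\<close> lies in the range of \<open>P \<nu> ^^ n\<close>, so
      does \<open>z\<close>: the factor \<open>A\<close> is cancelled.\<close>
    moreover from this obtain u where "z = (P \<nu> ^^ n) u"
      using P_power_in_range_A by metis
    ultimately have "y = (P \<nu> ^^ Suc n) u" by simp
    then show "y \<in> range (P \<nu> ^^ Suc n)" by blast
  next
    fix y assume "y \<in> range (P \<nu> ^^ Suc n)"
    then obtain u where u: "y = P \<nu> ((P \<nu> ^^ n) u)" by auto
    let ?x = "A ((P \<nu> ^^ n) u)"
    have "?x = (P \<nu> ^^ n) (A u)" by (simp add: P_power_A)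
    then have "?x \<in> range (P \<nu> ^^ n)" by (rule range_eqI)
    moreover have "pencil_op \<nu> ?x = Some y" using u pencil_op_iff by blast
    ultimately have "(pencil_op \<nu> |` range (P \<nu> ^^ n)) ?x = Some y"
      by (simp only: restrict_map_def if_True)
    then show "y \<in> ran (pencil_op \<nu> |` range (P \<nu> ^^ n))" by (rule ranI)
  qed
  have range_sub: "range (P \<nu> ^^ Suc n) \<subseteq> range (P \<nu> ^^ n)" for n
    using decseq_range_P_power by (rule decseq_SucD)
  have dom_sub: "dom (pencil_op \<nu> |` Y) \<subseteq> Y" for Y
    by (simp only: dom_restrict Int_lower2)
  show ?thesis
    unfolding B_Fredholm_def Fredholm_in_def ran_op_power null ran
    by (simp only: closed_operator_pencil_op closed_operator_restrict[OF subspace_range_P_power]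
        range_sub dom_sub simp_thms cong: conj_cong)
qed

section \<open>Drazin invertibility against the B-Fredholm property\<close>

lemma ascent_finite_iff:
  "ascent (pencil_op \<nu>) \<noteq> \<infinity> \<longleftrightarrow> (\<exists>n. \<forall>x. (P \<nu> ^^ Suc n) x = 0 \<longrightarrow> (P \<nu> ^^ n) x = 0)"
proof -
  have "ascent (pencil_op \<nu>) \<noteq> \<infinity> \<longleftrightarrow>
      (\<exists>n. {x. (P \<nu> ^^ n) x = 0} = {x. (P \<nu> ^^ Suc n) x = 0})"
    unfolding ascent_def nullspace_op_power Suc_eq_plus1[symmetric] by (rule Inf_enat_finite_iff)
  moreover have "(P \<nu> ^^ Suc n) x = 0" if "(P \<nu> ^^ n) x = 0" for n x
    using that by (simp add: P_linear)
  ultimately show ?thesis by blast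
qed

lemma descent_finite_iff:
  "descent (pencil_op \<nu>) \<noteq> \<infinity> \<longleftrightarrow> (\<exists>n. range (P \<nu> ^^ Suc n) = range (P \<nu> ^^ n))"
  unfolding descent_def ran_op_power Suc_eq_plus1[symmetric] Inf_enat_finite_iff
  by (rule iff_exI) (rule eq_commute)

text \<open>On the range of a sufficiently high power \<open>P \<nu>\<close> is bijective, so kernel
  and cokernel there are zero.\<close>

lemma Drazin_imp_B_Fredholm:
  assumes "Drazin_invertible (pencil_op \<nu>)"
  shows "B_Fredholm (pencil_op \<nu>)"
proof -
  obtain p q where pq: "\<And>x. (P \<nu> ^^ Suc p) x = 0 \<Longrightarrow> (P \<nu> ^^ p) x = 0"
    "range (P \<nu> ^^ Suc q) = range (P \<nu> ^^ q)"
    using assms unfolding Drazin_invertible_def ascent_finite_iff descent_finite_iff by blast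
  obtain n where n: "closed (range (P \<nu> ^^ n))" "range (P \<nu> ^^ Suc n) = range (P \<nu> ^^ n)"
    "\<And>x. x \<in> range (P \<nu> ^^ n) \<Longrightarrow> P \<nu> x = 0 \<Longrightarrow> x = 0"
    by (rule closed_range_of_finite_ascent_descent[OF pq]) (assumption, rule that)
  have "{x \<in> range (P \<nu> ^^ n). P \<nu> x = 0} = complex_vector.span {}"
    using n(3) complex_vector.subspace_0[OF subspace_kernel_on_range[of n \<nu>]] by auto
  then have "finite_dimensional {x \<in> range (P \<nu> ^^ n). P \<nu> x = 0}"
    unfolding finite_dimensional_def by blast
  moreover have "finite_codimensional_in Y Y" for Y :: "'a set"
    unfolding finite_codimensional_in_def by (intro exI[of _ "{}"]) simp
  ultimately show ?thesis
    unfolding B_Fredholm_pencil_op_iff using n(1) by (intro exI[of _ n] conjI) (simp_all only: n(2))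
qed

text \<open>The second claim is the local information that lets bijectivity spread over the
  plane.\<close>

lemma B_Fredholm_imp_Drazin:
  assumes "B_Fredholm (pencil_op \<nu>)" and "\<nu> \<in> closure {\<mu>. bij (P \<mu>)}"
  shows "Drazin_invertible (pencil_op \<nu>)"
    and "\<exists>\<epsilon>>0. \<forall>\<mu>. \<mu> \<noteq> \<nu> \<longrightarrow> dist \<mu> \<nu> < \<epsilon> \<longrightarrow> bij (P \<mu>)"
proof -
  obtain n where "closed (range (P \<nu> ^^ n))"
    "finite_dimensional {x \<in> range (P \<nu> ^^ n). P \<nu> x = 0}"
    "finite_codimensional_in (range (P \<nu> ^^ n)) (range (P \<nu> ^^ Suc n))"
    using assms(1) unfolding B_Fredholm_pencil_op_iff by blast
  then obtain m \<epsilon> where "\<And>x. (P \<nu> ^^ Suc m) x = 0 \<Longrightarrow> (P \<nu> ^^ m) x = 0"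
    "range (P \<nu> ^^ Suc m) = range (P \<nu> ^^ m)"
    "\<epsilon> > 0" "\<And>\<mu>. \<mu> \<noteq> \<nu> \<Longrightarrow> dist \<mu> \<nu> < \<epsilon> \<Longrightarrow> bij (P \<mu>)"
    by (rule B_Fredholm_point[OF _ _ _ assms(2)]) blast
  then show "Drazin_invertible (pencil_op \<nu>)"
    and "\<exists>\<epsilon>>0. \<forall>\<mu>. \<mu> \<noteq> \<nu> \<longrightarrow> dist \<mu> \<nu> < \<epsilon> \<longrightarrow> bij (P \<mu>)"
    unfolding Drazin_invertible_def ascent_finite_iff descent_finite_iff by blast+
qed

lemma bij_P_0: "bij (P 0)"
proof -
  have "P 0 = id" by (simp add: P_def fun_eq_iff)
  then show ?thesis by (simp only: bij_id)
qed

lemma bij_imp_Drazin_invertible: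
  assumes "bij (P \<nu>)"
  shows "Drazin_invertible (pencil_op \<nu>)"
proof -
  have "x = 0" if "P \<nu> x = 0" for x
    using assms that P_linear(1)[of \<nu>] by (metis bij_is_inj injD)
  then have "\<forall>x. (P \<nu> ^^ Suc 0) x = 0 \<longrightarrow> (P \<nu> ^^ 0) x = 0" by simp
  moreover have "range (P \<nu> ^^ Suc 0) = range (P \<nu> ^^ 0)"
    using bij_is_surj[OF assms] by simp
  ultimately show ?thesis
    unfolding Drazin_invertible_def ascent_finite_iff descent_finite_iff by blast
qed

text \<open>The resolvent is \<open>A\<close> after the inverse of \<open>P \<nu>\<close>, bounded
  by the open mapping theorem. Conversely, \<open>R\<close> recovers \<open>A u\<close> from
  \<open>P \<nu> u\<close>, and \<open>A\<close> is injective.\<close>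

lemma resolvent_iff_bij:
  "(\<exists>R. bounded_linear R \<and> (\<forall>x y. pencil_op \<nu> x = Some y \<longleftrightarrow> R y = x)) \<longleftrightarrow> bij (P \<nu>)"
proof
  assume "\<exists>R. bounded_linear R \<and> (\<forall>x y. pencil_op \<nu> x = Some y \<longleftrightarrow> R y = x)"
  then obtain R where "bounded_linear R" and R: "\<And>x y. (\<exists>z. x = A z \<and> y = P \<nu> z) \<longleftrightarrow> R y = x"
    unfolding pencil_op_iff by blast
  show "bij (P \<nu>)"
  proof (rule bijI)
    show "inj (P \<nu>)"
    proof (rule injI)
      fix u v assume "P \<nu> u = P \<nu> v"
      then have "A u = A v" using R[of "A u" "P \<nu> u"] R[of "A v" "P \<nu> u"] by metis
      then show "u = v" by (simp add: A_eq_iff)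
    qed
    have "y \<in> range (P \<nu>)" for y
      using R[of "R y" y] by blast
    then show "surj (P \<nu>)" by (intro subset_antisym subset_UNIV subsetI)
  qed
next
  assume bij: "bij (P \<nu>)"
  define Q where "Q = inv (P \<nu>)"
  have PQ: "P \<nu> (Q y) = y" and QP: "Q (P \<nu> y) = y" for y
    unfolding Q_def
    by (rule surj_f_inv_f[OF bij_is_surj[OF bij]], rule inv_f_f[OF bij_is_inj[OF bij]])
  obtain K where K: "\<And>y. y \<in> range (P \<nu>) \<Longrightarrow> \<exists>x\<in>UNIV. P \<nu> x = y \<and> norm x \<le> K * norm y"
    by (rule open_mapping_on[OF bounded_linear_P[of \<nu>] subspace_UNIV closed_UNIV])
      (simp add: bij_is_surj[OF bij], rule that)
  have "bounded_linear Q"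
  proof (rule bounded_linear_intro[of _ K])
    show "Q (x + y) = Q x + Q y" for x y
      by (metis PQ QP P_linear(2))
    show "Q (r *\<^sub>R x) = r *\<^sub>R Q x" for r x
      by (metis PQ QP P_linear(4) scaleR_scaleC)
    show "norm (Q y) \<le> norm y * K" for y
      using K[of y] bij_is_surj[OF bij] QP by (metis UNIV_I mult.commute)
  qed
  then have "bounded_linear (\<lambda>y. A (Q y))" by (rule bounded_linear_compose[OF A])
  moreover have "pencil_op \<nu> x = Some y \<longleftrightarrow> A (Q y) = x" for x y
    unfolding pencil_op_iff using PQ QP by metis
  ultimately show "\<exists>R. bounded_linear R \<and> (\<forall>x y. pencil_op \<nu> x = Some y \<longleftrightarrow> R y = x)"
    by blast
qed

text \<open>The closure of the set of bijective parameters is open and the plane is connected. The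
  closure is taken because \<open>P \<nu>\<close> itself may fail to be bijective while all its
  close neighbours are.\<close>

lemma all_Drazin_invertible:
  assumes "\<And>\<nu>. B_Fredholm (pencil_op \<nu>)"
  shows "Drazin_invertible (pencil_op \<nu>)"
proof -
  let ?C = "closure {\<mu>. bij (P \<mu>)}"
  have "open ?C"
    unfolding open_dist
  proof
    fix \<nu> assume \<nu>: "\<nu> \<in> ?C"
    then obtain \<epsilon> where \<epsilon>: "\<epsilon> > 0" "\<forall>\<mu>. \<mu> \<noteq> \<nu> \<longrightarrow> dist \<mu> \<nu> < \<epsilon> \<longrightarrow> bij (P \<mu>)"
      using B_Fredholm_imp_Drazin(2)[OF assms \<nu>] by blast
    have "\<mu> \<in> ?C" if "dist \<mu> \<nu> < \<epsilon>" for \<mu>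
      using \<epsilon>(2) \<nu> that closure_subset[of "{\<mu>. bij (P \<mu>)}"] by (cases "\<mu> = \<nu>") auto
    then show "\<exists>e>0. \<forall>\<mu>. dist \<mu> \<nu> < e \<longrightarrow> \<mu> \<in> ?C" using \<epsilon>(1) by blast
  qed
  moreover have "?C \<noteq> {}" using bij_P_0 by auto
  ultimately have "?C = UNIV" using clopen[of ?C] by (metis closed_closure)
  then show ?thesis using B_Fredholm_imp_Drazin(1)[OF assms] by simp
qed

end

section \<open>Transfer to the operator \<open>T\<close>\<close>

text \<open>\<open>A\<close> is the resolvent at \<open>\<mu>\<close>, complex homogeneous because
  \<open>T\<close> is; subtracting \<open>\<kappa>\<close> from \<open>T\<close> subtracts
  \<open>\<kappa> - \<mu>\<close> from the inverse of \<open>A\<close>.\<close>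

lemma resolvent_pencil:
  assumes T: "linear_operator T" and \<mu>: "\<mu> \<in> resolvent_set T"
  obtains A where "injective_pencil A"
    "\<And>\<kappa>. op_shift T \<kappa> = injective_pencil.pencil_op A (\<kappa> - \<mu>)"
proof -
  obtain A where A: "bounded_linear A" and shift: "\<And>x y. op_shift T \<mu> x = Some y \<longleftrightarrow> A y = x"
    using \<mu> unfolding resolvent_set_def by blast
  interpret A: bounded_linear A by (rule A)
  have T_iff: "T x = Some u \<longleftrightarrow> A (u - \<mu> *\<^sub>C x) = x" for x u
  proof -
    have "T x = Some u \<longleftrightarrow> op_shift T \<mu> x = Some (u - \<mu> *\<^sub>C x)"
      by (cases "T x") (auto simp: op_shift_def)
    then show ?thesis using shift by simp
  qed
  have inj: "inj A"
    using shift by (metis injI option.inject)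
  have scale: "A (c *\<^sub>C y) = c *\<^sub>C A y" for c y
  proof -
    have "T (A y) = Some (y + \<mu> *\<^sub>C A y)" by (simp add: T_iff)
    then have "T (c *\<^sub>C A y) = Some (c *\<^sub>C (y + \<mu> *\<^sub>C A y))"
      using T unfolding linear_operator_def by blast
    moreover have "c *\<^sub>C (y + \<mu> *\<^sub>C A y) - \<mu> *\<^sub>C c *\<^sub>C A y = c *\<^sub>C y"
      by (simp add: scaleC_add_right scaleC_scaleC mult.commute)
    ultimately show ?thesis by (simp add: T_iff)
  qed
  interpret injective_pencil A
    by unfold_locales (use A scale inj in auto)
  have "op_shift T \<kappa> = pencil_op (\<kappa> - \<mu>)" for \<kappa>
  proof
    fix x
    have "op_shift T \<kappa> x = Some y \<longleftrightarrow> pencil_op (\<kappa> - \<mu>) x = Some y" for y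
    proof -
      have "op_shift T \<kappa> x = Some y \<longleftrightarrow> T x = Some (y + \<kappa> *\<^sub>C x)"
        by (cases "T x") (auto simp: op_shift_def algebra_simps)
      also have "\<dots> \<longleftrightarrow> A (y + (\<kappa> - \<mu>) *\<^sub>C x) = x"
        by (simp add: T_iff complex_vector.scale_left_diff_distrib algebra_simps)
      also have "\<dots> \<longleftrightarrow> (\<exists>z. x = A z \<and> y = P (\<kappa> - \<mu>) z)"
        by (auto simp: P_def intro!: exI[of _ "y + (\<kappa> - \<mu>) *\<^sub>C x"])
      finally show ?thesis by (simp only: pencil_op_iff)
    qed
    then show "op_shift T \<kappa> x = pencil_op (\<kappa> - \<mu>) x"
      by (metis not_Some_eq)
  qed
  then show ?thesis using that injective_pencil_axioms by blast
qed

theorem corollary2p3: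
  fixes T :: "'a::complex_banach \<rightharpoonup> 'a"
  assumes "closed_operator T"
    and "resolvent_set T \<noteq> {}"
  shows "purely_B_discrete_spectrum T \<longleftrightarrow> B_Fredholm_spectrum T = {}"
proof -
  obtain \<mu> where \<mu>: "\<mu> \<in> resolvent_set T" using assms(2) by blast
  have T: "linear_operator T" using assms(1) unfolding closed_operator_def ..
  obtain A where "injective_pencil A"
    and shift: "\<And>\<kappa>. op_shift T \<kappa> = injective_pencil.pencil_op A (\<kappa> - \<mu>)"
    by (rule resolvent_pencil[OF T \<mu>]) (rule that)
  then interpret injective_pencil A by simp
  have res: "\<kappa> \<in> resolvent_set T \<longleftrightarrow> bij (P (\<kappa> - \<mu>))" for \<kappa>
    unfolding resolvent_set_def shift by (simp add: resolvent_iff_bij)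
  have Drazin: "Drazin_invertible (op_shift T \<kappa>)" if "\<kappa> \<in> resolvent_set T" for \<kappa>
    using that unfolding res shift by (rule bij_imp_Drazin_invertible)
  \<comment> \<open>Resolvent points are Drazin invertible anyway, so the condition on the spectrum
    extends to all \<open>\<kappa>\<close>.\<close>
  have "purely_B_discrete_spectrum T \<longleftrightarrow> (\<forall>\<kappa>. Drazin_invertible (op_shift T \<kappa>))"
    using Drazin unfolding purely_B_discrete_spectrum_def B_discrete_spectrum_def
      Drazin_spectrum_def spectrum_def by blast
  also have "\<dots> \<longleftrightarrow> (\<forall>\<kappa>. B_Fredholm (op_shift T \<kappa>))"
  proof
    assume "\<forall>\<kappa>. Drazin_invertible (op_shift T \<kappa>)"
    then show "\<forall>\<kappa>. B_Fredholm (op_shift T \<kappa>)"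
      unfolding shift by (blast intro: Drazin_imp_B_Fredholm)
  next
    assume fredholm: "\<forall>\<kappa>. B_Fredholm (op_shift T \<kappa>)"
    \<comment> \<open>Every parameter \<open>\<nu>\<close> occurs, namely for
      \<open>\<kappa> = \<nu> + \<mu>\<close>.\<close>
    have "B_Fredholm (pencil_op \<nu>)" for \<nu>
      using fredholm[rule_format, of "\<nu> + \<mu>"] unfolding shift by simp
    then show "\<forall>\<kappa>. Drazin_invertible (op_shift T \<kappa>)"
      unfolding shift by (intro allI all_Drazin_invertible)
  qed
  also have "\<dots> \<longleftrightarrow> B_Fredholm_spectrum T = {}"
    unfolding B_Fredholm_spectrum_def by blast
  finally show ?thesis .
qed

end
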